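(* The set $\Omega_{SB}\subset\mathbb{R}^2$ of all $(\mu,\nu)$ for which $T_{\mu\nu}$ has at least one nonzero bounded orbit is a closed subset of $\mathbb{R}^2$. Moreover, $\Omega_{SB}$ consists exactly of those $(\mu,\nu)\in\mathbb{R}^2$ for which, with $a=\nu+\mu$ and $b=\nu-\mu$, one of the following conditions holds: (1) the rotation number $r(S_{ab})$ is rational, and $T_{ab}$ has a nonzero periodic orbit; (2) the rotation number $r(S_{ab})$ is irrational.
   Context: For $(a,b)\in\mathbb{R}^2$ let $T_{ab}:\mathbb{R}^2\to\mathbb{R}^2$ be the homeomorphism $T_{ab}(x,y)=(ax-y,x)$ if $x\ge 0$ and $T_{ab}(x,y)=(bx-y,x)$ if $x<0$. The parameters $(\mu,\nu)\in\mathbb{R}^2$ are related to $(a,b)$ by $\mu=\frac12(a-b)$, $\nu=\frac12(a+b)$, i.e. $a=\nu+\mu$, $b=\nu-\mu$; one writes $T_{\mu\nu}$ for the same map $T_{ab}$. The orbit of $\mathbf{v}\in\mathbb{R}^2$ is the two-sided sequence $\{T_{ab}^{(n)}(\mathbf{v}):n\in\mathbb{Z}\}$, where $T^{(n)}$ denotes the $n$-th iterate (also for negative $n$). It is nonzero if $\mathbf{v}\ne(0,0)$, bounded if it is a bounded subset of $\mathbb{R}^2$, and periodic if $T_{ab}^{(k)}(\mathbf{v})=\mathbf{v}$ for some $k\ge1$. $T_{ab}$ maps rays from the origin to rays from the origin, and it induces the orientation-preserving circle homeomorphism $S_{ab}=S_{\mu\nu}:S^1\to S^1$, $S_{ab}(\mathbf{u})=T_{ab}(\mathbf{u})/|T_{ab}(\mathbf{u})|$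 (with $S^1$ the unit circle in $\mathbb{R}^2$). Its (counterclockwise) rotation number $r(S_{ab})\in[0,1)$ is normalized so that a full turn counts as $1$; it is known that it always lies in $[0,\frac12]$. *)

theory Defs
  imports "HOL-Analysis.Analysis"
begin

definition T_map :: "real \<Rightarrow> real \<Rightarrow> real \<times> real \<Rightarrow> real \<times> real" where
  "T_map a b = (\<lambda>(x, y). if x \<ge> 0 then (a * x - y, x) else (b * x - y, x))"

lemma bij_T_map: "bij (T_map a b)"
proof (rule o_bij)
  let ?g = "\<lambda>(x, y). if y \<ge> 0 then (y, a * y - x) else (y, b * y - x)"
  show "?g \<circ> T_map a b = id" "T_map a b \<circ> ?g = id"
    by (auto simp: T_map_def fun_eq_iff)
qed

definition int_iterate :: "('a \<Rightarrow> 'a) \<Rightarrow> int \<Rightarrow> 'a \<Rightarrow> 'a" where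
  "int_iterate f n = (if n \<ge> 0 then f ^^ nat n else inv f ^^ nat (- n))"

definition two_sided_orbit :: "('a \<Rightarrow> 'a) \<Rightarrow> 'a \<Rightarrow> 'a set" where
  "two_sided_orbit f v = range (\<lambda>n. int_iterate f n v)"

definition periodic_point :: "('a \<Rightarrow> 'a) \<Rightarrow> 'a \<Rightarrow> bool" where
  "periodic_point f v \<longleftrightarrow> (\<exists>k\<ge>1. (f ^^ k) v = v)"

text \<open>The Euclidean unit circle is \<open>sphere 0 1\<close>; only the values of the
  following map there are relevant.\<close>

definition S_map :: "real \<Rightarrow> real \<Rightarrow> real \<times> real \<Rightarrow> real \<times> real" where
  "S_map a b u = T_map a b u /\<^sub>R norm (T_map a b u)"

definition circle_point :: "real \<Rightarrow> real \<times> real" where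
  "circle_point t = (cos (2 * pi * t), sin (2 * pi * t))"

text \<open>\<open>F\<close> is a lift of the orientation-preserving circle homeomorphism \<open>f\<close>
  to the universal cover \<open>circle_point\<close>, which runs counterclockwise with a full turn
  of length 1. Two such lifts of \<open>f\<close> differ by an integer constant.\<close>

definition circle_lift :: "(real \<times> real \<Rightarrow> real \<times> real) \<Rightarrow> (real \<Rightarrow> real) \<Rightarrow> bool" where
  "circle_lift f F \<longleftrightarrow>
     continuous_on UNIV F \<and> strict_mono F \<and> (\<forall>t. F (t + 1) = F t + 1) \<and>
     (\<forall>t. circle_point (F t) = f (circle_point t))"

text \<open>Poincare's rotation number: the translation number of any lift, reduced modulo 1
  to \<open>[0, 1)\<close>.\<close>

definition rotation_number :: "(real \<times> real \<Rightarrow> real \<times> real) \<Rightarrow> real" where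
  "rotation_number f =
     (THE r. \<exists>F \<rho>. circle_lift f F \<and>
        (\<forall>t. (\<lambda>n. (F ^^ n) t / real n) \<longlonglongrightarrow> \<rho>) \<and> r = frac \<rho>)"

definition Omega_SB :: "(real \<times> real) set" where
  "Omega_SB = {(\<mu>, \<nu>). \<exists>v. v \<noteq> (0, 0) \<and>
     bounded (two_sided_orbit (T_map (\<nu> + \<mu>) (\<nu> - \<mu>)) v)}"

end

theory Submission
  imports Defs
begin

text \<open>
  Closedness: if an orbit is bounded and not zero, rescaling a nearly longest vector of it gives a
  unit vector whose whole orbit has norm at most 2. So \<open>Omega_SB\<close> is the projection of
  a closed set along the compact circle.

  Rational rotation number: some power of the lift, minus an integer, has a fixed point, so the
  directions of a bounded orbit converge to a periodic direction. As \<open>T_map\<close> preserves area,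
  the derivative of the circle map is the inverse square of the stretching factor of
  \<open>T_map\<close>; a limit direction that is stretched makes the orbit unbounded, and one that is
  shrunk is repelling. So the limit direction consists of periodic vectors.

  Irrational rotation number: if no orbit were bounded, then by compactness every vector would
  double its length within a uniformly bounded time in the past or in the future, hence grow
  exponentially in one of the two time directions. By the same derivative formula the circle map or
  its inverse contracts intervals of uniform size around such points, and a close return of an
  orbit gives an interval that is mapped into itself by a power of the lift, hence a periodic
  direction, and the rotation number is rational. Time reversal is conjugation with the swap of
  the coordinates.
\<close>

section \<open>Translation numbers of circle lifts\<close>


lemma circle_point_eq_iff: "circle_point s = circle_point t \<longleftrightarrow> s - t \<in> \<int>"
proof -
  have "circle_point s = circle_point t \<longleftrightarrow> (\<exists>n::int. 2 * pi * s = 2 * pi * t + 2 * pi * real_of_int n)"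
    using sin_cos_eq_iff[of "2 * pi * s" "2 * pi * t"] by (auto simp: circle_point_def)
  also have "\<dots> \<longleftrightarrow> (\<exists>n::int. s - t = real_of_int n)"
  proof -
    have "2 * pi * s = 2 * pi * t + 2 * pi * real_of_int n \<longleftrightarrow> s - t = real_of_int n" for n
    proof -
      have "2 * pi * s = 2 * pi * t + 2 * pi * real_of_int n \<longleftrightarrow> 2 * pi * (s - t) = 2 * pi * real_of_int n"
        by (simp add: algebra_simps) 
      then show ?thesis by simp
    qed
    then show ?thesis by simp
  qed
  also have "\<dots> \<longleftrightarrow> s - t \<in> \<int>"
    by (auto elim: Ints_cases)
  finally show ?thesis .
qed

text \<open>Distinct integers lie at distance at least 1. Serves both for the difference of two
  lifts and for the degree of one lift.\<close>

lemma continuous_Ints_valued_constant: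
  fixes g :: "real \<Rightarrow> real"
  assumes "continuous_on UNIV g" "\<And>t. g t \<in> \<int>"
  shows "\<exists>m::int. \<forall>t. g t = m"
proof -
  have "g constant_on UNIV"
  proof (rule continuous_discrete_range_constant[OF _ assms(1)])
    show "connected (UNIV :: real set)" by simp
    fix x :: real
    have "1 \<le> norm (g y - g x)" if "g y \<noteq> g x" for y
    proof -
      obtain i j where "g y = of_int i" "g x = of_int j"
        using assms(2) by (meson Ints_cases)
      then show ?thesis
        using that by (simp flip: of_int_diff add: Ints_nonzero_abs_ge1)
    qed
    then show "\<exists>e>0. \<forall>y. y \<in> UNIV \<and> g y \<noteq> g x \<longrightarrow> e \<le> norm (g y - g x)"
      by (intro exI[of _ 1]) auto
  qed
  then obtain c where c: "\<And>t. g t = c" by (auto simp: constant_on_def)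
  then have "c \<in> \<int>" using assms(2) by metis
  then show ?thesis using c by (metis Ints_cases)
qed

text \<open>The circle map itself is left out, so that every iterate \<open>F ^^ n\<close> is an
  instance again and inherits all facts proved here.\<close>

locale degree_one_lift =
  fixes F :: "real \<Rightarrow> real"
  assumes cont: "continuous_on UNIV F"
    and smono: "strict_mono F"
    and degree: "F (t + 1) = F t + 1"
begin

lemma add_int: "F (t + of_int m) = F t + of_int m"
proof -
  have nat: "F (s + real n) = F s + real n" for s n
  proof (induction n)
    case (Suc n)
    then show ?case using degree[of "s + real n"] by (simp add: algebra_simps)
  qed simp
  show ?thesis
  proof (cases m rule: int_cases2)
    case (nonneg n)
    then show ?thesis using nat by simp
  next
    case (nonpos n)
    then show ?thesis using nat[of "t - real n" n] by simp
  qed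
qed

text \<open>\<open>F s - s\<close> has period 1, and within one period after \<open>t\<close> both
  \<open>F\<close> and the identity advance by an amount between 0 and 1.\<close>

lemma displacement: "\<bar>(F s - s) - (F t - t)\<bar> \<le> 1"
proof -
  define m where "m = \<lfloor>s - t\<rfloor>"
  define e where "e = s - t - of_int m"
  have e: "0 \<le> e" "e < 1" unfolding e_def m_def by linarith+
  have "F s = F (t + e) + of_int m"
    using add_int[of "t + e" m] by (simp add: e_def)
  moreover have "F t \<le> F (t + e)" "F (t + e) \<le> F (t + 1)"
    using e smono by (simp_all add: strict_mono_less_eq)
  moreover have "s = t + e + of_int m" by (simp add: e_def)
  ultimately show ?thesis using degree[of t] e by simp
qed

end

lemma (in degree_one_lift) degree_one_lift_funpow: "degree_one_lift (F ^^ n)"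
proof (induction n)
  case 0
  show ?case by unfold_locales (simp_all add: strict_mono_def)
next
  case (Suc n)
  interpret G: degree_one_lift "F ^^ n" by fact
  show ?case
  proof
    show "continuous_on UNIV (F ^^ Suc n)"
      using continuous_on_compose[OF G.cont continuous_on_subset[OF cont]] by simp
    show "strict_mono (F ^^ Suc n)"
      using smono G.smono by (auto simp: strict_mono_def)
    show "(F ^^ Suc n) (t + 1) = (F ^^ Suc n) t + 1" for t
      using degree G.degree by simp
  qed
qed

context degree_one_lift
begin

lemma funpow_add_int: "(F ^^ n) (t + of_int m) = (F ^^ n) t + of_int m"
  using degree_one_lift.add_int[OF degree_one_lift_funpow] .

lemma funpow_diff_int: "(F ^^ n) (t - of_int m) = (F ^^ n) t - of_int m"
  using funpow_add_int[of n t "- m"] by simp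

text \<open>Split the steps into \<open>n\<close> blocks of length \<open>m\<close>: by
  \<open>displacement\<close> for \<open>F ^^ m\<close>, each block advances by
  \<open>(F ^^ m) 0\<close> up to an error of 1.\<close>

lemma funpow_mult_displacement:
  "\<bar>(F ^^ (m * n)) 0 - real n * (F ^^ m) 0\<bar> \<le> real n"
proof (induction n)
  case (Suc n)
  have "(F ^^ (m * Suc n)) 0 = (F ^^ m) ((F ^^ (m * n)) 0)"
    by (simp add: funpow_add)
  then have "\<bar>(F ^^ (m * Suc n)) 0 - (F ^^ (m * n)) 0 - (F ^^ m) 0\<bar> \<le> 1"
    using degree_one_lift.displacement[OF degree_one_lift_funpow, of m "(F ^^ (m * n)) 0" 0] by simp
  with Suc show ?case by (simp add: algebra_simps)
qed simp

lemma translation_number_exists: "\<exists>\<rho>. \<forall>t. (\<lambda>n. (F ^^ n) t / real n) \<longlonglongrightarrow> \<rho>"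
proof -
  define q where "q n = (F ^^ n) 0 / real n" for n
  \<comment> \<open>Both quotients are compared with the iterate of order \<open>m * n\<close>, seen
    as \<open>n\<close> blocks of \<open>m\<close> steps and as \<open>m\<close> blocks of
    \<open>n\<close> steps.\<close>
  have close: "\<bar>q m - q n\<bar> \<le> 1 / real m + 1 / real n" if "m > 0" "n > 0" for m n
  proof -
    have "\<bar>real n * (F ^^ m) 0 - real m * (F ^^ n) 0\<bar> \<le> real n + real m"
      using funpow_mult_displacement[of m n] funpow_mult_displacement[of n m]
      by (simp add: mult.commute)
    moreover have "real n * (F ^^ m) 0 - real m * (F ^^ n) 0 = (real m * real n) * (q m - q n)"
      using that by (simp add: q_def field_simps)
    moreover have "real n + real m = (real m * real n) * (1 / real m + 1 / real n)"
      using that by (simp add: field_simps)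
    ultimately have "(real m * real n) * \<bar>q m - q n\<bar> \<le> (real m * real n) * (1 / real m + 1 / real n)"
      using that by (simp add: abs_mult)
    then show ?thesis using that by simp
  qed
  have "Cauchy q"
  proof (rule metric_CauchyI)
    fix e :: real assume "0 < e"
    then obtain M where M: "M > 0" "1 / real M < e / 2"
      by (metis half_gt_zero nat_approx_posE of_nat_0_less_iff zero_less_Suc)
    have "dist (q m) (q n) < e" if "m \<ge> M" "n \<ge> M" for m n
    proof -
      have "1 / real m \<le> 1 / real M" "1 / real n \<le> 1 / real M"
        using that M by (auto intro!: divide_left_mono)
      then show ?thesis using close[of m n] that M by (simp add: dist_real_def)
    qed
    then show "\<exists>M. \<forall>m\<ge>M. \<forall>n\<ge>M. dist (q m) (q n) < e" by blast
  qed
  then obtain \<rho> where \<rho>: "q \<longlonglongrightarrow> \<rho>"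
    using Cauchy_convergent convergentD by blast
  have "(\<lambda>n. (F ^^ n) t / real n) \<longlonglongrightarrow> \<rho>" for t
  proof -
    have "(\<lambda>n. (F ^^ n) t / real n - q n) \<longlonglongrightarrow> 0"
    proof (rule Lim_null_comparison)
      show "\<forall>\<^sub>F n in sequentially. norm ((F ^^ n) t / real n - q n) \<le> (1 + \<bar>t\<bar>) / real n"
      proof (rule always_eventually, rule allI)
        fix n
        \<comment> \<open>The distance of the two orbits is bounded independently of
          \<open>n\<close>, so all starting points share one limit.\<close>
        have "\<bar>(F ^^ n) t - (F ^^ n) 0\<bar> \<le> 1 + \<bar>t\<bar>"
          using degree_one_lift.displacement[OF degree_one_lift_funpow, of n t 0] by simp
        then show "norm ((F ^^ n) t / real n - q n) \<le> (1 + \<bar>t\<bar>) / real n"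
          by (simp add: q_def divide_right_mono flip: diff_divide_distrib)
      qed
      show "(\<lambda>n. (1 + \<bar>t\<bar>) / real n) \<longlonglongrightarrow> 0"
        by (rule lim_const_over_n)
    qed
    from tendsto_add[OF this \<rho>] show ?thesis by simp
  qed
  then show ?thesis by blast
qed

text \<open>A point that moves by exactly \<open>p\<close> in \<open>q\<close> steps moves by
  \<open>k * p\<close> in \<open>q * k\<close> steps; this subsequence determines the limit.\<close>

lemma translation_number_periodic:
  assumes "q \<ge> 1" "(F ^^ q) s = s + of_int p" "(\<lambda>n. (F ^^ n) s / real n) \<longlonglongrightarrow> \<rho>"
  shows "\<rho> = of_int p / real q"
proof -
  have it: "(F ^^ (q * k)) s = s + real k * of_int p" for k
  proof (induction k)
    case (Suc k)
    have "(F ^^ (q * Suc k)) s = (F ^^ q) (s + of_int (int k * p))"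
      using Suc by (simp add: funpow_add)
    then show ?case using assms(2) by (simp only: funpow_add_int) (simp add: algebra_simps)
  qed simp
  have lim1: "(\<lambda>k. (F ^^ (q * k)) s / real (q * k)) \<longlonglongrightarrow> \<rho>"
    using LIMSEQ_subseq_LIMSEQ[OF assms(3), of "\<lambda>k. q * k"] assms(1)
    by (auto simp: strict_mono_def o_def)
  have lim2: "(\<lambda>k. (F ^^ (q * k)) s / real (q * k)) \<longlonglongrightarrow> 0 + of_int p / real q"
  proof (rule Lim_transform_eventually)
    show "(\<lambda>k. (s / real q) / real k + of_int p / real q) \<longlonglongrightarrow> 0 + of_int p / real q"
      by (intro tendsto_intros lim_const_over_n)
    show "\<forall>\<^sub>F k in sequentially. (s / real q) / real k + of_int p / real q = (F ^^ (q * k)) s / real (q * k)"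
      using eventually_gt_at_top[of 0]
      by eventually_elim (use assms(1) in \<open>unfold it, simp add: field_simps\<close>)
  qed
  show ?thesis using LIMSEQ_unique[OF lim1 lim2] by simp
qed

text \<open>Without a periodic point, the displacement of the \<open>q\<close>-th iterate keeps a uniform distance
  from the integer \<open>p\<close>, on one side of it.\<close>

lemma translation_number_rational:
  assumes "q \<ge> 1" "(\<lambda>n. (F ^^ n) 0 / real n) \<longlonglongrightarrow> of_int p / real q"
  shows "\<exists>s. (F ^^ q) s = s + of_int p"
proof (rule ccontr)
  assume no: "\<not> ?thesis"
  interpret G: degree_one_lift "F ^^ q" by (rule degree_one_lift_funpow)
  define d where "d t = (F ^^ q) t - t - of_int p" for t
  have contd: "continuous_on A d" for A
    unfolding d_def by (intro continuous_intros continuous_on_subset[OF G.cont]) auto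
  have nz: "d t \<noteq> 0" for t
  proof
    assume "d t = 0"
    then have "(F ^^ q) t = t + of_int p" by (simp add: d_def)
    with no show False by blast
  qed
  have per: "d t = d (frac t)" for t
    using G.add_int[of "t - of_int \<lfloor>t\<rfloor>" "\<lfloor>t\<rfloor>"] by (simp add: d_def frac_def)
  have lim: "(\<lambda>k. (F ^^ (q * k)) 0 / real (q * k)) \<longlonglongrightarrow> of_int p / real q"
    using LIMSEQ_subseq_LIMSEQ[OF assms(2), of "\<lambda>k. q * k"] assms(1)
    by (auto simp: strict_mono_def o_def)
  have step: "(F ^^ (q * Suc k)) 0 = (F ^^ (q * k)) 0 + of_int p + d ((F ^^ (q * k)) 0)" for k
    by (simp add: d_def funpow_add)
  \<comment> \<open>\<open>\<sigma>\<close> is the sign of \<open>d 0\<close> and treats both signs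
    at once. By the intermediate value theorem \<open>d\<close> keeps its sign; by periodicity all
    its values occur on a compact interval, which gives the uniform bound.\<close>
  have inf: "\<exists>e>0. \<forall>t. e \<le> \<sigma> * d t" if \<sigma>: "\<sigma> * d 0 > 0" "\<bar>\<sigma>\<bar> = 1" for \<sigma>
  proof -
    have pos: "\<sigma> * d t > 0" for t
    proof (rule ccontr)
      assume "\<not> \<sigma> * d t > 0"
      moreover have "connected (range (\<lambda>t. \<sigma> * d t))"
        by (intro connected_continuous_image continuous_intros contd) simp
      ultimately have "0 \<in> range (\<lambda>t. \<sigma> * d t)"
        using \<sigma>(1) connectedD_interval[of "range (\<lambda>t. \<sigma> * d t)" "\<sigma> * d t" "\<sigma> * d 0" 0]
        by (metis less_imp_le not_less rangeI)
      then show False using nz \<sigma>(2) by fastforce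
    qed
    obtain x where "x \<in> {0..1}" "\<forall>y\<in>{0..1}. \<sigma> * d x \<le> \<sigma> * d y"
      using continuous_attains_inf[of "{0..1::real}" "\<lambda>t. \<sigma> * d t"]
        continuous_on_mult[OF continuous_on_const contd] by auto
    moreover have "frac t \<in> {0..1}" for t
      by (simp add: frac_lt_1 less_imp_le)
    ultimately have "\<sigma> * d x \<le> \<sigma> * d (frac t)" for t by blast
    then have "\<sigma> * d x \<le> \<sigma> * d t" for t
      by (simp flip: per)
    then show ?thesis using pos by blast
  qed
  obtain \<sigma> where \<sigma>: "\<sigma> * d 0 > 0" "\<bar>\<sigma>\<bar> = (1::real)"
  proof (cases "d 0 > 0")
    case True then show ?thesis using that[of 1] by simp
  next
    case False then show ?thesis using that[of "-1"] nz[of 0] by simp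
  qed
  obtain e where e: "e > 0" "\<And>t. e \<le> \<sigma> * d t" using inf[OF \<sigma>] by blast
  have grow: "real k * e \<le> \<sigma> * ((F ^^ (q * k)) 0 - real k * of_int p)" for k
  proof (induction k)
    case (Suc k)
    then show ?case using e(2)[of "(F ^^ (q * k)) 0"] step[of k]
      by (simp add: algebra_simps)
  qed simp
  \<comment> \<open>The assumed limit makes this mean drift tend to 0, while \<open>grow\<close>
    keeps it at least \<open>e / real q\<close>.\<close>
  have "(\<lambda>k. \<sigma> * ((F ^^ (q * k)) 0 / real (q * k) - of_int p / real q)) \<longlonglongrightarrow>
      \<sigma> * (of_int p / real q - of_int p / real q)"
    by (intro tendsto_intros lim)
  moreover have "\<forall>\<^sub>F k in sequentially. e / real q \<le>
      \<sigma> * ((F ^^ (q * k)) 0 / real (q * k) - of_int p / real q)"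
    using eventually_gt_at_top[of 0]
  proof eventually_elim
    case (elim k)
    have "\<sigma> * ((F ^^ (q * k)) 0 / real (q * k) - of_int p / real q)
        = \<sigma> * ((F ^^ (q * k)) 0 - real k * of_int p) / real (q * k)"
      using elim assms(1) by (simp add: field_simps)
    also have "\<dots> \<ge> real k * e / real (q * k)"
      using grow by (rule divide_right_mono) simp
    finally show ?case using elim by simp
  qed
  ultimately have "e / real q \<le> \<sigma> * (of_int p / real q - of_int p / real q)"
    by (intro tendsto_lowerbound) auto
  then show False using e(1) assms(1) by (simp add: divide_le_0_iff)
qed

end

section \<open>Rotation numbers in terms of lifts\<close>

lemma circle_lift_degree_one_lift: "circle_lift f F \<Longrightarrow> degree_one_lift F"
  by (simp add: circle_lift_def degree_one_lift_def)

text \<open>Settles the definite description: two lifts differ by a constant integer, hence so do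
  their translation numbers, and \<open>frac\<close> removes the difference.\<close>

lemma rotation_number_eq:
  assumes F: "circle_lift f F" and \<rho>: "\<And>t. (\<lambda>n. (F ^^ n) t / real n) \<longlonglongrightarrow> \<rho>"
  shows "rotation_number f = frac \<rho>"
  unfolding rotation_number_def
proof (rule the_equality)
  show "\<exists>F' \<rho>'. circle_lift f F' \<and> (\<forall>t. (\<lambda>n. (F' ^^ n) t / real n) \<longlonglongrightarrow> \<rho>') \<and> frac \<rho> = frac \<rho>'"
    using assms by blast
next
  fix r
  assume "\<exists>F' \<rho>'. circle_lift f F' \<and> (\<forall>t. (\<lambda>n. (F' ^^ n) t / real n) \<longlonglongrightarrow> \<rho>') \<and> r = frac \<rho>'"
  then obtain F' \<rho>' where F': "circle_lift f F'"
    and \<rho>': "\<And>t. (\<lambda>n. (F' ^^ n) t / real n) \<longlonglongrightarrow> \<rho>'" and r: "r = frac \<rho>'" by blast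
  interpret degree_one_lift F using F by (rule circle_lift_degree_one_lift)
  have "\<exists>m::int. \<forall>t. F' t - F t = m"
  proof (rule continuous_Ints_valued_constant[of "\<lambda>t. F' t - F t"])
    show "continuous_on UNIV (\<lambda>t. F' t - F t)"
      using F F' by (auto simp: circle_lift_def intro!: continuous_intros)
    show "F' t - F t \<in> \<int>" for t
      using F F' by (simp add: circle_lift_def flip: circle_point_eq_iff)
  qed
  then obtain m :: int where m: "\<And>t. F' t - F t = m" by blast
  have "(F' ^^ n) 0 = (F ^^ n) 0 + of_int (int n * m)" for n
  proof (induction n)
    case (Suc n)
    then have "(F' ^^ Suc n) 0 = F ((F ^^ n) 0 + of_int (int n * m)) + of_int m"
      using m[of "(F' ^^ n) 0"] by (simp add: algebra_simps)
    then show ?case by (simp only: add_int) (simp add: algebra_simps)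
  qed simp
  then have eq: "(F' ^^ n) 0 / real n = (F ^^ n) 0 / real n + of_int m" if "n > 0" for n
    using that by (simp add: field_simps)
  have "(\<lambda>n. (F' ^^ n) 0 / real n) \<longlonglongrightarrow> \<rho> + of_int m"
    by (rule Lim_transform_eventually[OF tendsto_add[OF \<rho>[of 0] tendsto_const]])
      (use eventually_gt_at_top[of "0::nat"] in \<open>eventually_elim, simp add: eq\<close>)
  then have "\<rho>' = \<rho> + of_int m"
    using \<rho>'[of 0] LIMSEQ_unique by blast
  then show "r = frac \<rho>" using r by (simp add: frac_def)
qed

text \<open>The final argument uses the rotation number only through this dynamical
  criterion.\<close>

lemma rotation_number_rational_iff:
  assumes F: "circle_lift f F"
  shows "rotation_number f \<in> \<rat> \<longleftrightarrow> (\<exists>q\<ge>1. \<exists>s. \<exists>p::int. (F ^^ q) s = s + p)"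
proof -
  interpret degree_one_lift F using F by (rule circle_lift_degree_one_lift)
  obtain \<rho> where \<rho>: "\<And>t. (\<lambda>n. (F ^^ n) t / real n) \<longlonglongrightarrow> \<rho>"
    using translation_number_exists by blast
  have "rotation_number f \<in> \<rat> \<longleftrightarrow> \<rho> \<in> \<rat>"
    using Rats_add[of "\<rho> - of_int \<lfloor>\<rho>\<rfloor>" "of_int \<lfloor>\<rho>\<rfloor>"] Rats_diff[of \<rho> "of_int \<lfloor>\<rho>\<rfloor>"]
    unfolding rotation_number_eq[OF F \<rho>] frac_def by auto
  also have "\<dots> \<longleftrightarrow> (\<exists>q\<ge>1. \<exists>s. \<exists>p::int. (F ^^ q) s = s + p)"
  proof
    assume "\<rho> \<in> \<rat>"
    then obtain p :: int and q :: nat where "q \<noteq> 0" "\<rho> = of_int p / real q"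
      by (auto simp: Rats_eq_int_div_nat)
    moreover from this have "q \<ge> 1" by simp
    ultimately show "\<exists>q\<ge>1. \<exists>s. \<exists>p::int. (F ^^ q) s = s + p"
      using translation_number_rational \<rho>[of 0] by blast
  next
    assume "\<exists>q\<ge>1. \<exists>s. \<exists>p::int. (F ^^ q) s = s + p"
    then show "\<rho> \<in> \<rat>"
      using translation_number_periodic[OF _ _ \<rho>] by force
  qed
  finally show ?thesis .
qed

section \<open>The angular derivative\<close>


lemma T_map_nonneg: "fst v \<ge> 0 \<Longrightarrow> T_map a b v = (a * fst v - snd v, fst v)"
  by (cases v) (simp add: T_map_def)

lemma T_map_nonpos: "fst v \<le> 0 \<Longrightarrow> T_map a b v = (b * fst v - snd v, fst v)"
  by (cases v) (auto simp: T_map_def)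

text \<open>A form without case distinction, from which continuity is immediate, also jointly in the
  parameters.\<close>

lemma T_map_abs: "T_map a b v = ((a + b) / 2 * fst v + (a - b) / 2 * \<bar>fst v\<bar> - snd v, fst v)"
  by (cases v) (auto simp: T_map_def field_simps)

lemma T_map_scaleR: "c \<ge> 0 \<Longrightarrow> T_map a b (c *\<^sub>R v) = c *\<^sub>R T_map a b v"
  unfolding T_map_abs by (simp add: abs_mult algebra_simps)

lemma T_map_zero [simp]: "T_map a b 0 = 0"
  using T_map_scaleR[of 0] by simp

lemma T_map_eq_0_iff [simp]: "T_map a b v = 0 \<longleftrightarrow> v = 0"
  using bij_T_map[of a b, THEN bij_is_inj] by (metis T_map_zero injD)

lemma T_map_funpow_scaleR: "c \<ge> 0 \<Longrightarrow> (T_map a b ^^ n) (c *\<^sub>R v) = c *\<^sub>R (T_map a b ^^ n) v"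
  by (induction n) (simp_all add: T_map_scaleR)

lemma T_map_funpow_eq_0_iff [simp]: "(T_map a b ^^ n) v = 0 \<longleftrightarrow> v = 0"
  by (induction n) simp_all

lemma continuous_on_T_map [continuous_intros]:
  "continuous_on S f \<Longrightarrow> continuous_on S (\<lambda>x. T_map a b (f x))"
  unfolding T_map_abs by (intro continuous_intros)

lemma norm_circle_point [simp]: "norm (circle_point t) = 1"
  by (simp add: circle_point_def norm_Pair)

lemma circle_point_nonzero [simp]: "circle_point t \<noteq> 0"
  using norm_circle_point[of t] by (metis norm_zero zero_neq_one)

lemma continuous_on_circle_point [continuous_intros]:
  fixes f :: "'a::t2_space \<Rightarrow> real"
  shows "continuous_on S f \<Longrightarrow> continuous_on S (\<lambda>x. circle_point (f x))"
  unfolding circle_point_def by (intro continuous_intros)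

lemma polar_form: obtains t where "v = norm v *\<^sub>R circle_point t"
proof (cases "v = 0")
  case False
  define u where "u = v /\<^sub>R norm v"
  have u: "norm u = 1" "v = norm v *\<^sub>R u" using False by (simp_all add: u_def)
  then have "(fst u)\<^sup>2 + (snd u)\<^sup>2 = 1" by (simp add: norm_prod_def)
  then obtain \<theta> where "fst u = cos \<theta>" "snd u = sin \<theta>" by (rule sincos_total_2pi)
  then have "u = circle_point (\<theta> / (2 * pi))" by (simp add: circle_point_def prod_eq_iff)
  with u that show ?thesis by metis
qed (use that in simp)

text \<open>The determinant of the two vectors; for unit vectors it is the sine of the angle from
  the first to the second.\<close>

definition cross :: "real \<times> real \<Rightarrow> real \<times> real \<Rightarrow> real" where
  "cross u v = fst u * snd v - snd u * fst v"

lemma cross_scaleR: "cross (c *\<^sub>R u) (d *\<^sub>R v) = c * d * cross u v"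
  by (simp add: cross_def algebra_simps)

lemma cross_circle_point: "cross (circle_point s) (circle_point t) = sin (2 * pi * (t - s))"
  unfolding cross_def circle_point_def right_diff_distrib sin_diff by simp

lemma cross_T_map:
  assumes "fst u \<ge> 0 \<and> fst v \<ge> 0 \<or> fst u \<le> 0 \<and> fst v \<le> 0"
  shows "cross (T_map a b u) (T_map a b v) = cross u v"
  using assms by (auto simp: cross_def T_map_nonneg T_map_nonpos algebra_simps)

text \<open>Since \<open>f\<close> vanishes at \<open>t\<close>, the difference quotient of the
  product is that of \<open>f\<close> times \<open>g s\<close>, so continuity of \<open>g\<close> is
  enough. It will be applied with a factor built from the norm of \<open>T_map\<close>, which may
  have a kink.\<close>

lemma DERIV_mult_isCont_zero:
  fixes f g :: "real \<Rightarrow> real"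
  assumes f: "(f has_real_derivative D) (at t)" "f t = 0" and g: "isCont g t"
  shows "((\<lambda>s. f s * g s) has_real_derivative D * g t) (at t)"
proof -
  have "((\<lambda>s. (f s - f t) / (s - t) * g s) \<longlongrightarrow> D * g t) (at t)"
    using f(1) g by (intro tendsto_mult) (simp_all add: has_field_derivative_iff isCont_def)
  then show ?thesis using f(2) by (simp add: has_field_derivative_iff)
qed

text \<open>The kink of \<open>T_map\<close> on the line \<open>x = 0\<close> does no harm: every direction close to
  \<open>circle_point t\<close> shares a closed half-plane with it, and there \<open>T_map\<close> is linear with
  determinant 1.\<close>

lemma angular_derivative:
  assumes cont: "continuous_on UNIV F"
    and lift: "\<And>t. circle_point (F t) = S_map a b (circle_point t)"
  shows "(F has_real_derivative 1 / (norm (T_map a b (circle_point t)))\<^sup>2) (at t)"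
proof -
  define G where "G s = T_map a b (circle_point s)" for s
  define n where "n s = norm (G s)" for s
  have n_pos: "n s > 0" for s by (simp add: n_def G_def)
  have G: "G s = n s *\<^sub>R circle_point (F s)" for s
    using n_pos[of s] by (simp add: lift S_map_def n_def G_def)
  have "continuous_on UNIV n" unfolding n_def G_def by (intro continuous_intros)
  then have n_cont: "isCont n t" by (simp add: continuous_on_eq_continuous_at)
  have F_cont: "isCont F t" using cont by (simp add: continuous_on_eq_continuous_at)
  have "isCont (\<lambda>s. fst (circle_point s)) t"
    by (simp add: circle_point_def)
  then have c_lim: "((\<lambda>s. fst (circle_point s)) \<longlongrightarrow> fst (circle_point t)) (nhds t)"
    unfolding isCont_def by (rule tendsto_at_iff_tendsto_nhds[THEN iffD1])
  \<comment> \<open>If \<open>circle_point t\<close> lies on the kink line, it belongs to both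
    closed half-planes, so every \<open>s\<close> qualifies.\<close>
  have half: "\<forall>\<^sub>F s in nhds t. fst (circle_point t) \<ge> 0 \<and> fst (circle_point s) \<ge> 0
      \<or> fst (circle_point t) \<le> 0 \<and> fst (circle_point s) \<le> 0"
  proof (cases "fst (circle_point t)" "0 :: real" rule: linorder_cases)
    case less
    then have "\<forall>\<^sub>F s in nhds t. fst (circle_point s) < 0"
      using order_tendstoD(2)[OF c_lim] by simp
    then show ?thesis by eventually_elim (use less in auto)
  next
    case greater
    then have "\<forall>\<^sub>F s in nhds t. fst (circle_point s) > 0"
      using order_tendstoD(1)[OF c_lim] by simp
    then show ?thesis by eventually_elim (use greater in auto)
  qed (auto intro!: always_eventually)
  \<comment> \<open>For \<open>s\<close> near \<open>t\<close> this is the sine of the angle between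
    the images of the two directions: their \<open>cross\<close> divided by the product of their
    lengths.\<close>
  define \<phi> where "\<phi> s = sin (2 * pi * (s - t)) * (1 / (n t * n s))" for s
  have \<phi>: "(\<phi> has_real_derivative 2 * pi * (1 / (n t * n t))) (at t)"
    unfolding \<phi>_def
    by (rule DERIV_mult_isCont_zero)
      (use n_pos n_cont in \<open>auto intro!: derivative_eq_intros continuous_intros simp: less_le\<close>)
  have \<phi>0: "\<phi> t = 0" by (simp add: \<phi>_def)
  have "\<forall>\<^sub>F s in nhds t. dist (F s) (F t) < 1 / 4"
    using F_cont[unfolded isCont_def, THEN tendsto_at_iff_tendsto_nhds[THEN iffD1]]
    by (rule tendstoD) simp
  \<comment> \<open>Angles below a quarter turn lie where \<open>arcsin\<close> inverts
    \<open>sin\<close>, so near \<open>t\<close> the lift is an explicit function of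
    \<open>\<phi>\<close>.\<close>
  with half have "\<forall>\<^sub>F s in nhds t. F s = F t + arcsin (\<phi> s) / (2 * pi)"
  proof eventually_elim
    case (elim s)
    have "n t * n s * sin (2 * pi * (F s - F t)) = cross (G t) (G s)"
      by (simp add: G cross_scaleR cross_circle_point)
    also have "\<dots> = sin (2 * pi * (s - t))"
      unfolding G_def using elim(1) by (simp add: cross_T_map cross_circle_point)
    finally have "sin (2 * pi * (F s - F t)) = \<phi> s"
      using n_pos[of s] n_pos[of t] by (simp add: \<phi>_def field_simps)
    moreover have "\<bar>2 * pi * (F s - F t)\<bar> \<le> pi / 2"
      using elim(2) pi_gt_zero by (simp add: abs_mult dist_real_def)
    then have "arcsin (sin (2 * pi * (F s - F t))) = 2 * pi * (F s - F t)"
      by (intro arcsin_sin) linarith+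
    ultimately show ?case by simp
  qed
  from DERIV_cong_ev[OF refl this refl] have "(F has_real_derivative D) (at t) \<longleftrightarrow>
      ((\<lambda>s. F t + arcsin (\<phi> s) / (2 * pi)) has_real_derivative D) (at t)" for D .
  moreover have "((\<lambda>s. F t + arcsin (\<phi> s) / (2 * pi)) has_real_derivative 1 / (n t)\<^sup>2) (at t)"
    using n_pos[of t] 
    by (auto intro!: derivative_eq_intros \<phi> simp: \<phi>0 power2_eq_square)
  ultimately show ?thesis
    by (simp add: n_def G_def)
qed

text \<open>The two image vectors are positive multiples of each other, so homogeneity and
  injectivity of \<open>T_map\<close> make the directions equal.\<close>

lemma S_map_circle_point_inj:
  assumes "S_map a b (circle_point s) = S_map a b (circle_point t)"
  shows "s - t \<in> \<int>"
proof -
  define n where "n s = norm (T_map a b (circle_point s))" for s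
  have n_pos: "n s > 0" for s by (simp add: n_def)
  have "n t *\<^sub>R T_map a b (circle_point s) = n s *\<^sub>R T_map a b (circle_point t)"
    using assms n_pos[of s] n_pos[of t] unfolding S_map_def n_def[symmetric]
    by (metis (no_types, opaque_lifting) scaleR_left_commute scaleR_one right_inverse scaleR_scaleR less_irrefl)
  then have "T_map a b (n t *\<^sub>R circle_point s) = T_map a b (n s *\<^sub>R circle_point t)"
    using n_pos by (simp add: T_map_scaleR less_imp_le)
  then have eq: "n t *\<^sub>R circle_point s = n s *\<^sub>R circle_point t"
    using bij_T_map bij_is_inj injD by metis
  from arg_cong[OF this, of norm] have "n t = n s"
    using n_pos[of s] n_pos[of t] by simp
  with eq have "circle_point s = circle_point t"
    using n_pos[of s] by simp
  then show ?thesis by (simp add: circle_point_eq_iff)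
qed

text \<open>A continuous logarithm of the image curve in the complex plane supplies a continuous
  angle. It is increasing because its derivative is positive, and it has degree one because the
  circle map is injective.\<close>

lemma ex_circle_lift: "\<exists>F. circle_lift (S_map a b) F"
proof -
  define g where "g t = Complex (fst (T_map a b (circle_point t))) (snd (T_map a b (circle_point t)))" for t
  have g: "continuous_on UNIV g"
    unfolding g_def Complex_eq by (intro continuous_intros)
  have nz: "g t \<noteq> 0" for t
  proof
    assume "g t = 0"
    then have "T_map a b (circle_point t) = 0" by (simp add: g_def complex_eq_iff prod_eq_iff)
    then show False by simp
  qed
  obtain k where k: "continuous_on UNIV k" "\<And>t. g t = exp (k t)"
    using continuous_logarithm_on_contractible[OF g contractible_UNIV nz] by (metis UNIV_I)
  define F where "F t = Im (k t) / (2 * pi)" for t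
  have contF: "continuous_on A F" for A
    unfolding F_def using continuous_on_subset[OF k(1)] by (auto intro!: continuous_intros)
  have lift: "circle_point (F t) = S_map a b (circle_point t)" for t
  proof -
    have T: "T_map a b (circle_point t) = exp (Re (k t)) *\<^sub>R (cos (Im (k t)), sin (Im (k t)))"
      using k(2)[of t] by (simp add: g_def exp_eq_polar complex_eq_iff prod_eq_iff cis.simps Re_exp Im_exp)
    then have "norm (T_map a b (circle_point t)) = exp (Re (k t))"
      by (simp add: norm_Pair flip: scaleR_Pair)
    with T show ?thesis
      by (simp add: S_map_def circle_point_def F_def)
  qed
  have mono: "strict_mono F"
  proof (rule strict_monoI)
    fix s t :: real assume "s < t"
    then show "F s < F t"
    proof (rule DERIV_pos_imp_increasing)
      fix x
      show "\<exists>y. (F has_real_derivative y) (at x) \<and> 0 < y"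
        using angular_derivative[OF contF lift] by (intro exI conjI) auto
    qed
  qed
  have "\<exists>m::int. \<forall>t. F (t + 1) - F t = m"
  proof (rule continuous_Ints_valued_constant)
    show "continuous_on UNIV (\<lambda>t. F (t + 1) - F t)"
      by (intro continuous_intros continuous_on_compose2[OF contF[of UNIV]]) auto
    show "F (t + 1) - F t \<in> \<int>" for t
    proof -
      have "circle_point (t + 1) = circle_point t" by (simp add: circle_point_eq_iff)
      then have "circle_point (F (t + 1)) = circle_point (F t)" by (simp add: lift)
      then show ?thesis by (simp add: circle_point_eq_iff)
    qed
  qed
  then obtain m :: int where m: "\<And>t. F (t + 1) - F t = m" by blast
  have "F 0 < F 1" using mono by (simp add: strict_mono_less)
  with m[of 0] have "m \<ge> 1" by simp
  \<comment> \<open>With degree 2 or more, \<open>F\<close> would take the value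
    \<open>F 0 + 1\<close> strictly between 0 and 1, a second preimage of one direction.\<close>
  moreover have "\<not> m \<ge> 2"
  proof
    assume "m \<ge> 2"
    then have "F 0 + 1 < F 1" using m[of 0] by simp
    then obtain t where t: "0 \<le> t" "t \<le> 1" "F t = F 0 + 1"
      using IVT'[of F 0 "F 0 + 1" 1, OF _ _ _ contF] by auto
    then have "S_map a b (circle_point t) = S_map a b (circle_point 0)"
      by (simp add: circle_point_eq_iff flip: lift)
    then have "t \<in> \<int>" using S_map_circle_point_inj by fastforce
    with t have "t = 0 \<or> t = 1" by (auto elim!: Ints_cases)
    with t(3) \<open>F 0 + 1 < F 1\<close> show False by auto
  qed
  ultimately have "F (t + 1) = F t + 1" for t using m[of t] by simp
  with contF mono lift show ?thesis by (auto simp: circle_lift_def)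
qed

section \<open>Time reversal and two-sided orbits\<close>


text \<open>The coordinates are consecutive terms of a recurrence in which the sum of next and
  previous term depends only on the middle one, so reversing time just swaps them.\<close>

lemma inv_T_map: "inv (T_map a b) v = prod.swap (T_map a b (prod.swap v))"
proof -
  have "T_map a b (prod.swap (T_map a b (prod.swap v))) = v"
    by (cases v) (auto simp: T_map_def)
  then show ?thesis using bij_inv_eq_iff[OF bij_T_map] by metis
qed

lemma T_map_swap_T_map: "T_map a b (prod.swap (T_map a b v)) = prod.swap v"
  by (cases v) (auto simp: T_map_def)

lemma inv_T_map_funpow: "(inv (T_map a b) ^^ n) v = prod.swap ((T_map a b ^^ n) (prod.swap v))"
  by (induction n) (simp_all add: inv_T_map)

lemma norm_swap [simp]: "norm (prod.swap v) = norm (v :: real \<times> real)"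
  by (cases v) (simp add: norm_Pair add.commute)

lemma scaleR_swap: "prod.swap (c *\<^sub>R v) = c *\<^sub>R prod.swap v"
  by (cases v) simp

lemma swap_circle_point: "prod.swap (circle_point t) = circle_point (1 / 4 - t)"
proof -
  have "2 * pi * (1 / 4 - t) = pi / 2 - 2 * pi * t" by (simp add: algebra_simps)
  then show ?thesis unfolding circle_point_def by (simp add: cos_diff sin_diff)
qed

lemma int_iterate_nat: "int_iterate f (int n) = f ^^ n"
  by (simp add: int_iterate_def)

lemma int_iterate_minus: "int_iterate f (- int n) = inv f ^^ n"
  by (cases "n = 0") (simp_all add: int_iterate_def)

lemma int_iterate_add:
  assumes "bij f"
  shows "int_iterate f (m + n) x = int_iterate f m (int_iterate f n x)"
proof -
  have succ: "int_iterate f (n + 1) x = f (int_iterate f n x)" for n x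
  proof (cases n rule: int_cases)
    case (nonneg k)
    then show ?thesis using int_iterate_nat[of f "Suc k"] int_iterate_nat[of f k]
      by (simp add: add.commute)
  next
    case (neg k)
    then have "int_iterate f n x = inv f (int_iterate f (n + 1) x)"
      using int_iterate_minus[of f "Suc k"] int_iterate_minus[of f k] by simp
    then show ?thesis
      using surj_f_inv_f[OF bij_is_surj[OF assms]] by simp
  qed
  have pred: "int_iterate f (n - 1) x = inv f (int_iterate f n x)" for n x
    using succ[of "n - 1" x] inv_f_f[OF bij_is_inj[OF assms]] by simp
  show ?thesis
  proof (induction m rule: int_induct[of _ 0])
    case base
    then show ?case using int_iterate_nat[of f 0] by simp
  next
    case (step1 i)
    then show ?case using succ[of "i + n" x] succ[of i] by (simp add: ac_simps)
  next
    case (step2 i)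
    then show ?case using pred[of "i + n" x] pred[of i] by (simp add: algebra_simps)
  qed
qed

lemma int_iterate_T_map_minus:
  "int_iterate (T_map a b) (- int n) v = prod.swap ((T_map a b ^^ n) (prod.swap v))"
  by (simp add: int_iterate_minus inv_T_map_funpow)

lemma int_iterate_T_map_scaleR:
  assumes "c \<ge> 0"
  shows "int_iterate (T_map a b) n (c *\<^sub>R v) = c *\<^sub>R int_iterate (T_map a b) n v"
proof (cases n rule: int_cases2)
  case (nonneg k)
  show ?thesis unfolding nonneg int_iterate_nat by (rule T_map_funpow_scaleR[OF assms])
next
  case (nonpos k)
  show ?thesis
    unfolding nonpos int_iterate_T_map_minus scaleR_swap T_map_funpow_scaleR[OF assms] ..
qed

lemma int_iterate_T_map_eq_0_iff [simp]: "int_iterate (T_map a b) n v = 0 \<longleftrightarrow> v = 0"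
proof -
  have swap: "prod.swap w = 0 \<longleftrightarrow> w = 0" for w :: "real \<times> real"
    using norm_swap[of w] by (metis norm_eq_zero)
  show ?thesis
    by (cases n rule: int_cases2) (simp_all add: int_iterate_nat int_iterate_T_map_minus swap)
qed

section \<open>Joint continuity of the iterates and closedness of \<open>Omega_SB\<close>\<close>

lemma swap_eq_fst_snd: "prod.swap v = (snd v, fst v)"
  by (cases v) simp

text \<open>The parameters vary together with the vector, as closedness in the parameter plane
  requires.\<close>

lemma continuous_on_T_map_funpow:
  assumes "continuous_on S A" "continuous_on S B" "continuous_on S f"
  shows "continuous_on S (\<lambda>x. (T_map (A x) (B x) ^^ n) (f x))"
proof (induction n)
  case (Suc n)
  then show ?case using assms unfolding funpow.simps o_apply T_map_abs
    by (intro continuous_intros) auto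
qed (simp add: assms)

lemma continuous_on_int_iterate_T_map:
  assumes "continuous_on S A" "continuous_on S B" "continuous_on S f"
  shows "continuous_on S (\<lambda>x. int_iterate (T_map (A x) (B x)) n (f x))"
proof (cases n rule: int_cases2)
  case (nonneg k)
  then show ?thesis
    by (simp only: int_iterate_nat) (intro continuous_on_T_map_funpow assms)
next
  case (nonpos k)
  then show ?thesis
    by (simp only: int_iterate_T_map_minus swap_eq_fst_snd)
      (intro continuous_on_Pair continuous_on_fst continuous_on_snd continuous_on_T_map_funpow assms)
qed

text \<open>Homogeneity trades a bound depending on the orbit for the fixed bound 2 and a normalized
  start, which makes the condition suitable for a compactness argument.\<close>

lemma Omega_SB_iff_small_orbit:
  "(\<mu>, \<nu>) \<in> Omega_SB \<longleftrightarrow>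
    (\<exists>u. norm u = 1 \<and> (\<forall>n. norm (int_iterate (T_map (\<nu> + \<mu>) (\<nu> - \<mu>)) n u) \<le> 2))"
proof -
  define T where "T = T_map (\<nu> + \<mu>) (\<nu> - \<mu>)"
  have "(\<exists>v. v \<noteq> (0, 0) \<and> bounded (two_sided_orbit T v)) \<longleftrightarrow>
      (\<exists>u. norm u = 1 \<and> (\<forall>n. norm (int_iterate T n u) \<le> 2))"
  proof
    assume "\<exists>v. v \<noteq> (0, 0) \<and> bounded (two_sided_orbit T v)"
    then obtain v where v: "v \<noteq> 0" and bdd: "bounded (two_sided_orbit T v)"
      by (auto simp: zero_prod_def)
    define M where "M = (SUP n. norm (int_iterate T n v))"
    have "bdd_above (range (\<lambda>n. norm (int_iterate T n v)))"
      using bdd by (auto simp: two_sided_orbit_def bounded_iff bdd_above_def)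
    then have M: "norm (int_iterate T n v) \<le> M" for n
      unfolding M_def by (rule cSUP_upper[OF UNIV_I])
    have "norm (int_iterate T 0 v) > 0" using v by (simp add: T_def)
    with M[of 0] have "M > 0" by linarith
    then have "M / 2 < M" by simp
    \<comment> \<open>The supremum need not be attained, so an orbit point above half of it is
      rescaled to length 1; this is the source of the bound 2.\<close>
    then obtain k where k: "M / 2 < norm (int_iterate T k v)"
      unfolding M_def by (metis UNIV_not_empty cSUP_least not_less)
    define w where "w = int_iterate T k v"
    have w: "norm w > M / 2" "norm w > 0"
      using k \<open>M > 0\<close> unfolding w_def by linarith+
    have "norm (int_iterate T n (w /\<^sub>R norm w)) \<le> 2" for n
    proof -
      have "norm (int_iterate T n (w /\<^sub>R norm w)) = norm (int_iterate T (n + k) v) / norm w"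
      proof -
        have "int_iterate T n (w /\<^sub>R norm w) = int_iterate T (n + k) v /\<^sub>R norm w"
          using w(2) by (simp only: T_def int_iterate_T_map_scaleR int_iterate_add[OF bij_T_map] w_def
            inverse_nonnegative_iff_nonnegative less_imp_le)
        then show ?thesis using w(2) by (simp add: divide_inverse mult.commute)
      qed
      also have "\<dots> \<le> M / norm w" using M w by (simp add: divide_right_mono)
      also have "\<dots> \<le> 2" using w by (simp add: field_simps)
      finally show ?thesis .
    qed
    moreover have "norm (w /\<^sub>R norm w) = 1" using w by simp
    ultimately show "\<exists>u. norm u = 1 \<and> (\<forall>n. norm (int_iterate T n u) \<le> 2)" by blast
  next
    assume "\<exists>u. norm u = 1 \<and> (\<forall>n. norm (int_iterate T n u) \<le> 2)"
    then obtain u where "norm u = 1" "\<And>n. norm (int_iterate T n u) \<le> 2" by blast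
    then have "u \<noteq> (0, 0)" "bounded (two_sided_orbit T u)"
      by (auto simp: two_sided_orbit_def bounded_iff simp flip: zero_prod_def)
    then show "\<exists>v. v \<noteq> (0, 0) \<and> bounded (two_sided_orbit T v)" by blast
  qed
  then show ?thesis by (simp add: Omega_SB_def T_def)
qed

text \<open>For each \<open>n\<close> the bound is a closed condition on vector and parameters
  jointly, hence so is their intersection \<open>K\<close>; the vector is then projected away along
  the unit circle.\<close>

lemma closed_Omega_SB: "closed Omega_SB"
proof -
  define K where "K = {z :: (real \<times> real) \<times> (real \<times> real).
    \<forall>n. norm (int_iterate (T_map (snd (snd z) + fst (snd z)) (snd (snd z) - fst (snd z))) n (fst z)) \<le> 2}"
  have "closed K"
    unfolding K_def
    by (intro closed_Collect_all closed_Collect_le continuous_intros continuous_on_int_iterate_T_map)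
  then have "closed {x. \<exists>u. u \<in> sphere 0 1 \<and> (u, x) \<in> K}"
    by (intro closed_compact_projection) auto
  also have "{x. \<exists>u. u \<in> sphere 0 1 \<and> (u, x) \<in> K} = Omega_SB"
  proof (rule set_eqI)
    fix x :: "real \<times> real"
    show "x \<in> {x. \<exists>u. u \<in> sphere 0 1 \<and> (u, x) \<in> K} \<longleftrightarrow> x \<in> Omega_SB"
      by (cases x) (simp only: K_def Omega_SB_iff_small_orbit mem_Collect_eq mem_sphere_0 fst_conv snd_conv)
  qed
  finally show ?thesis .
qed

section \<open>Linear growth in one time direction\<close>

text \<open>The points \<open>m k\<close> obtained by iterating the doubling hypothesis go to infinity
  linearly and with bounded gaps, so they finally stay on one side of the origin.\<close>

lemma linear_growth_one_sided:
  fixes N :: nat and c :: real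
  assumes "c > 0"
  obtains B where "\<And>f :: int \<Rightarrow> real.
    (\<And>n. \<bar>f (n + 1) - f n\<bar> \<le> c) \<Longrightarrow> (\<And>n. \<exists>m. \<bar>m - n\<bar> \<le> int N \<and> f m \<ge> f n + 1) \<Longrightarrow>
    (\<forall>n. f (int n) \<ge> f 0 + n / N - B) \<or> (\<forall>n. f (- int n) \<ge> f 0 + n / N - B)"
proof
  \<comment> \<open>From index \<open>K\<close> on, \<open>f\<close> has risen by more than
    \<open>c * N\<close>, so by the Lipschitz bound \<open>m k\<close> is farther than
    \<open>N\<close> from 0.\<close>
  define K where "K = nat \<lceil>c * N\<rceil> + 1"
  \<comment> \<open>The first two summands pay for \<open>n \<le> K * N\<close>, where only the
    Lipschitz bound is used, the last one for replacing \<open>n\<close> by a nearby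
    \<open>m k\<close>. Neither constant depends on \<open>f\<close>.\<close>
  define B where "B = c * (K * N) + K + c * N"
  fix f :: "int \<Rightarrow> real"
  assume f: "\<And>n. \<bar>f (n + 1) - f n\<bar> \<le> c" and doubling: "\<And>n. \<exists>m. \<bar>m - n\<bar> \<le> int N \<and> f m \<ge> f n + 1"
  have K: "real K > c * N" unfolding K_def by linarith
  have lip: "\<bar>f x - f y\<bar> \<le> c * real_of_int \<bar>x - y\<bar>" for x y
  proof -
    have *: "\<bar>f (y + int k) - f y\<bar> \<le> c * k" for y k
    proof (induction k)
      case (Suc k)
      then show ?case using f[of "y + int k"] by (simp add: algebra_simps)
    qed simp
    show ?thesis
    proof (cases "x \<ge> y")
      case True
      then show ?thesis using *[of y "nat (x - y)"] by simp
    next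
      case False
      then show ?thesis using *[of x "nat (y - x)"] by simp
    qed
  qed
  obtain g where g: "\<And>n. \<bar>g n - n\<bar> \<le> int N" "\<And>n. f (g n) \<ge> f n + 1"
    using doubling by metis
  define m where "m k = (g ^^ k) 0" for k
  have m0: "m 0 = 0" and step: "\<bar>m (Suc k) - m k\<bar> \<le> int N" for k
    using g(1) by (simp_all add: m_def)
  have up: "f (m k) \<ge> f 0 + k" for k
  proof (induction k)
    case (Suc k)
    then show ?case using g(2)[of "m k"] by (simp add: m_def)
  qed (simp add: m_def)
  have m_le: "\<bar>m k\<bar> \<le> int (k * N)" for k
  proof (induction k)
    case (Suc k)
    then show ?case using step[of k] by simp
  qed (simp add: m0)
  have m_ge: "real k \<le> c * real_of_int \<bar>m k\<bar>" for k
    using lip[of "m k" 0] up[of k] by simp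
  have m_big: "\<bar>m k\<bar> > int N" if "k \<ge> K" for k
  proof -
    have "c * real N < c * real_of_int \<bar>m k\<bar>"
      using that K m_ge[of k] by linarith
    then show ?thesis using assms by simp
  qed
  define \<sigma> where "\<sigma> = sgn (m K)"
  have \<sigma>: "\<sigma> = 1 \<or> \<sigma> = -1" using m_big[of K] by (auto simp: \<sigma>_def sgn_if)
  \<comment> \<open>A jump of length at most \<open>N\<close> cannot cross the interval from
    \<open>-N\<close> to \<open>N\<close>, so the sign found at \<open>K\<close> persists.\<close>
  have m_sgn: "\<sigma> * m k > int N" if "k \<ge> K" for k
    using that
  proof (induction k rule: dec_induct)
    case base
    then show ?case using m_big[of K] by (simp add: \<sigma>_def abs_sgn mult.commute)
  next
    case (step k)
    then show ?case using m_big[of "Suc k"] \<open>\<bar>m (Suc k) - m k\<bar> \<le> int N\<close> \<sigma> by auto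
  qed
  have main: "f (\<sigma> * int n) \<ge> f 0 + n / N - B" for n
  proof (cases "int n < \<sigma> * m K")
    case True
    have "\<sigma> * m K \<le> int (K * N)" using m_le[of K] \<sigma> by auto
    with True have n: "n \<le> K * N" by linarith
    then have "real n \<le> real K * real N" by (metis of_nat_le_iff of_nat_mult)
    moreover from this have "real n / N \<le> K" by (cases "N = 0") (simp_all add: divide_le_eq)
    moreover have "f (\<sigma> * int n) \<ge> f 0 - c * n" using lip[of "\<sigma> * int n" 0] \<sigma> by auto
    moreover have "c * real n \<le> c * (real K * real N)" using calculation(1) assms by simp
    moreover have "0 \<le> c * real N" using assms by simp
    ultimately show ?thesis unfolding B_def of_nat_mult by linarith
  next
    case False
    \<comment> \<open>The first \<open>m k\<close> that reaches \<open>n\<close> overshoots by at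
      most \<open>N\<close>, and \<open>k\<close> is at least \<open>n / N\<close> because each jump
      is at most \<open>N\<close>.\<close>
    define P where "P k \<longleftrightarrow> k \<ge> K \<and> int n \<le> \<sigma> * m k" for k
    define k where "k = (LEAST k. P k)"
    have "P (max K (nat \<lceil>c * n\<rceil>))"
    proof -
      let ?k = "max K (nat \<lceil>c * n\<rceil>)"
      have "\<bar>m ?k\<bar> = \<sigma> * m ?k" using m_sgn[of ?k] \<sigma> by auto
      moreover have "c * n \<le> c * real_of_int \<bar>m ?k\<bar>"
        using m_ge[of ?k] real_nat_ceiling_ge[of "c * n"] of_nat_mono[OF max.cobounded2[of "nat \<lceil>c * n\<rceil>" K], where 'a = real]
        by linarith
      ultimately have "real_of_int (int n) \<le> real_of_int (\<sigma> * m ?k)" using assms by simp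
      then show ?thesis unfolding P_def of_int_le_iff by simp
    qed
    then have k: "P k" unfolding k_def by (rule LeastI)
    have "\<sigma> * m k \<le> int n + int N"
    proof (cases "k = K")
      case True
      then show ?thesis using False by simp
    next
      case neq: False
      define k' where "k' = k - 1"
      have k': "k = Suc k'" "k' \<ge> K" using k neq unfolding P_def k'_def by linarith+
      have "\<not> P k'" using k'(1) unfolding k_def by (metis lessI not_less_Least)
      then have "\<sigma> * m k' < int n" using k' unfolding P_def by simp
      then show ?thesis using step[of k'] k' \<sigma> by auto
    qed
    then have "\<bar>\<sigma> * int n - m k\<bar> \<le> int N" using k \<sigma> unfolding P_def by auto
    then have "real_of_int \<bar>\<sigma> * int n - m k\<bar> \<le> real_of_int (int N)" unfolding of_int_le_iff .
    then have "c * real_of_int \<bar>\<sigma> * int n - m k\<bar> \<le> c * N"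
      using assms by (intro mult_left_mono) simp_all
    then have "f (\<sigma> * int n) \<ge> f 0 + k - c * N"
      using lip[of "\<sigma> * int n" "m k"] up[of k] by linarith
    moreover have "int n \<le> int (k * N)"
      using k m_le[of k] \<sigma> unfolding P_def by auto
    then have "n \<le> k * N" by (rule of_nat_le_iff[THEN iffD1])
    then have "real n \<le> real k * real N" by (metis of_nat_le_iff of_nat_mult)
    then have "real n / N \<le> k" by (cases "N = 0") (simp_all add: divide_le_eq)
    moreover have "0 \<le> c * (real K * real N)" "0 \<le> real K" using assms by simp_all
    ultimately show ?thesis unfolding B_def of_nat_mult by linarith
  qed
  show "(\<forall>n. f (int n) \<ge> f 0 + n / N - B) \<or> (\<forall>n. f (- int n) \<ge> f 0 + n / N - B)"
    using \<sigma> main by auto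
qed

section \<open>Exponential growth and contraction\<close>


lemma norm_T_map_le: "norm (T_map a b v) \<le> (\<bar>a\<bar> + \<bar>b\<bar> + 2) * norm v"
proof -
  obtain x y where v: "v = (x, y)" by (cases v)
  have x: "\<bar>x\<bar> \<le> norm v" and y: "\<bar>y\<bar> \<le> norm v"
    using norm_fst_le[of x y] norm_snd_le[of y x] by (simp_all add: v)
  define d where "d = (if x \<ge> 0 then a else b)"
  have "norm (T_map a b v) = norm (d * x - y, x)"
    by (simp add: T_map_def v d_def)
  also have "\<dots> \<le> norm (d * x - y) + norm x" by (rule norm_Pair_le)
  also have "\<dots> \<le> \<bar>d\<bar> * \<bar>x\<bar> + \<bar>y\<bar> + \<bar>x\<bar>" by (simp flip: abs_mult)
  also have "\<bar>d\<bar> * \<bar>x\<bar> \<le> (\<bar>a\<bar> + \<bar>b\<bar>) * norm v"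
    using x by (intro mult_mono) (auto simp: d_def)
  finally show ?thesis using x y by (simp add: algebra_simps)
qed

text \<open>Time reversal turns the upper bound for the map into one for its inverse.\<close>

lemma norm_T_map_ge: "norm v \<le> (\<bar>a\<bar> + \<bar>b\<bar> + 2) * norm (T_map a b v)"
  using norm_T_map_le[of a b "prod.swap (T_map a b v)"] by (simp add: T_map_swap_T_map)

text \<open>By compactness finitely many times serve all unit vectors, so every nonzero vector
  doubles within \<open>N\<close> steps in the past or the future. The logarithm of the norm along
  an orbit then satisfies the hypotheses of \<open>linear_growth_one_sided\<close>, with constants
  independent of the vector.\<close>

lemma exponential_growth:
  assumes unbdd: "\<And>u. norm u = 1 \<Longrightarrow> \<exists>n. norm (int_iterate (T_map a b) n u) > 2"
  obtains A \<rho> where "A > 0" "\<rho> > 1" "\<And>v. norm v = 1 \<Longrightarrow>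
    (\<forall>n. norm ((T_map a b ^^ n) v) \<ge> A * \<rho> ^ n) \<or>
    (\<forall>n. norm ((T_map a b ^^ n) (prod.swap v)) \<ge> A * \<rho> ^ n)"
proof -
  let ?P = "int_iterate (T_map a b)"
  have "open {u. norm (?P n u) > 2}" for n
    by (intro open_Collect_less continuous_intros continuous_on_int_iterate_T_map)
  then obtain D where D: "finite D" "sphere 0 1 \<subseteq> (\<Union>n\<in>D. {u. norm (?P n u) > 2})"
    using compactE_image[OF compact_sphere, of UNIV "\<lambda>n. {u. norm (?P n u) > 2}" 0 1] unbdd
    by (auto simp: subset_iff)
  define N where "N = Suc (\<Sum>n\<in>D. nat \<bar>n\<bar>)"
  have N: "\<bar>n\<bar> \<le> int N" if "n \<in> D" for n
  proof -
    have "nat \<bar>n\<bar> \<le> (\<Sum>n\<in>D. nat \<bar>n\<bar>)" by (rule member_le_sum) (use that D(1) in auto)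
    then show ?thesis unfolding N_def by linarith
  qed
  have doubling: "\<exists>m. \<bar>m\<bar> \<le> int N \<and> norm (?P m v) \<ge> 2 * norm v" if "v \<noteq> 0" for v
  proof -
    have "v /\<^sub>R norm v \<in> sphere 0 1" using that by simp
    with D(2) obtain m where m: "m \<in> D" "norm (?P m (v /\<^sub>R norm v)) > 2" by blast
    then have "norm (?P m v) / norm v > 2"
      by (simp add: int_iterate_T_map_scaleR divide_inverse_commute)
    then have "norm (?P m v) \<ge> 2 * norm v" using that by (simp add: field_simps)
    then show ?thesis using N m(1) by blast
  qed
  define C where "C = \<bar>a\<bar> + \<bar>b\<bar> + 2"
  have C: "C > 1" by (simp add: C_def add_nonneg_pos)
  define c where "c = log 2 C"
  have "c > 0" using C by (simp add: c_def)
  then obtain B where B: "\<And>f :: int \<Rightarrow> real.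
    (\<And>n. \<bar>f (n + 1) - f n\<bar> \<le> c) \<Longrightarrow> (\<And>n. \<exists>m. \<bar>m - n\<bar> \<le> int N \<and> f m \<ge> f n + 1) \<Longrightarrow>
    (\<forall>n. f (int n) \<ge> f 0 + n / N - B) \<or> (\<forall>n. f (- int n) \<ge> f 0 + n / N - B)"
    using linear_growth_one_sided[of c N] by blast
  \<comment> \<open>Base 2 exponentials of the slope \<open>1 / N\<close>, and below of the loss
    \<open>B\<close>.\<close>
  define \<rho> where "\<rho> = 2 powr (1 / N)"
  define A where "A = 2 powr (- B)"
  have A_\<rho>: "x \<ge> A * \<rho> ^ n" if "x > 0" "log 2 x \<ge> n / N - B" for x n
  proof -
    have "A * \<rho> ^ n = 2 powr (n / N - B)"
      by (simp add: A_def \<rho>_def powr_power divide_inverse mult.commute flip: powr_add)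
    also have "\<dots> \<le> x" using that by (simp add: le_log_iff)
    finally show ?thesis .
  qed
  have "(\<forall>n. norm ((T_map a b ^^ n) v) \<ge> A * \<rho> ^ n) \<or>
    (\<forall>n. norm ((T_map a b ^^ n) (prod.swap v)) \<ge> A * \<rho> ^ n)" if v: "norm v = 1" for v
  proof -
    define f where "f n = log 2 (norm (?P n v))" for n
    have nz: "v \<noteq> 0" using v by auto
    have pos: "norm (?P n v) > 0" for n using nz by simp
    have P0: "?P 0 v = v" using int_iterate_nat[of "T_map a b" 0] by simp
    have "\<bar>f (n + 1) - f n\<bar> \<le> c" for n
    proof -
      have "?P (n + 1) v = T_map a b (?P n v)"
        using int_iterate_add[OF bij_T_map, of a b 1 n v] int_iterate_nat[of "T_map a b" 1]
        by (simp add: add.commute)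
      then have "norm (?P (n + 1) v) \<le> C * norm (?P n v)" "norm (?P n v) \<le> C * norm (?P (n + 1) v)"
        using norm_T_map_le norm_T_map_ge unfolding C_def by simp_all
      then have "f (n + 1) \<le> log 2 (C * norm (?P n v))" "f n \<le> log 2 (C * norm (?P (n + 1) v))"
        unfolding f_def using pos C by (simp_all add: del: int_iterate_T_map_eq_0_iff)
      then have "f (n + 1) \<le> c + f n" "f n \<le> c + f (n + 1)"
        using pos[of n] pos[of "n + 1"] C unfolding f_def c_def
        by (simp_all add: log_mult_pos del: int_iterate_T_map_eq_0_iff)
      then show ?thesis by linarith
    qed
    moreover have "\<exists>m. \<bar>m - n\<bar> \<le> int N \<and> f m \<ge> f n + 1" for n
    proof -
      obtain m where m: "\<bar>m\<bar> \<le> int N" "norm (?P m (?P n v)) \<ge> 2 * norm (?P n v)"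
        using doubling[of "?P n v"] pos[of n] by auto
      then have "log 2 (2 * norm (?P n v)) \<le> f (m + n)"
        unfolding f_def int_iterate_add[OF bij_T_map] using pos[of n] pos[of "m + n"]
        by (simp add: int_iterate_add[OF bij_T_map])
      then have "f (m + n) \<ge> f n + 1"
        using pos[of n] unfolding f_def by (simp add: log_mult_pos)
      then show ?thesis using m(1) by (intro exI[of _ "m + n"]) simp
    qed
    ultimately have "(\<forall>n. f (int n) \<ge> f 0 + n / N - B) \<or> (\<forall>n. f (- int n) \<ge> f 0 + n / N - B)"
      by (rule B)
    moreover have "f 0 = 0" by (simp add: f_def P0 v)
    ultimately have "(\<forall>n::nat. norm (?P (int n) v) \<ge> A * \<rho> ^ n) \<or> (\<forall>n::nat. norm (?P (- int n) v) \<ge> A * \<rho> ^ n)"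
      using A_\<rho>[OF pos] unfolding f_def by force
    then show ?thesis unfolding int_iterate_nat int_iterate_T_map_minus norm_swap .
  qed
  moreover have "A > 0" by (simp add: A_def)
  moreover have "N > 0" by (simp add: N_def)
  then have "\<rho> > 1" unfolding \<rho>_def by (intro gr_one_powr) simp_all
  ultimately show ?thesis using that by blast
qed

section \<open>Stretching factors and contraction of the lift\<close>

locale T_map_lift =
  fixes a b :: real and F :: "real \<Rightarrow> real"
  assumes circle_lift: "circle_lift (S_map a b) F"
begin

sublocale degree_one_lift F
  using circle_lift by (rule circle_lift_degree_one_lift)

abbreviation T where "T \<equiv> T_map a b"

lemma lift: "circle_point (F t) = S_map a b (circle_point t)"
  using circle_lift by (simp add: circle_lift_def)

lemma T_circle_point: "T (circle_point t) = norm (T (circle_point t)) *\<^sub>R circle_point (F t)"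
  by (simp add: lift S_map_def)

lemma T_funpow_circle_point:
  "(T ^^ n) (circle_point t) = norm ((T ^^ n) (circle_point t)) *\<^sub>R circle_point ((F ^^ n) t)"
proof (induction n)
  case (Suc n)
  define c where "c = norm ((T ^^ n) (circle_point t))"
  have "(T ^^ Suc n) (circle_point t) = T (c *\<^sub>R circle_point ((F ^^ n) t))"
    using Suc by (simp add: c_def)
  also have "\<dots> = c *\<^sub>R T (circle_point ((F ^^ n) t))"
    by (simp add: T_map_scaleR c_def)
  also have "T (circle_point ((F ^^ n) t)) =
      norm (T (circle_point ((F ^^ n) t))) *\<^sub>R circle_point ((F ^^ Suc n) t)"
    using T_circle_point by simp
  also have "c *\<^sub>R \<dots> = (c * norm (T (circle_point ((F ^^ n) t)))) *\<^sub>R circle_point ((F ^^ Suc n) t)"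
    by (rule scaleR_scaleR)
  finally have eq: "(T ^^ Suc n) (circle_point t) =
      (c * norm (T (circle_point ((F ^^ n) t)))) *\<^sub>R circle_point ((F ^^ Suc n) t)" .
  then have "norm ((T ^^ Suc n) (circle_point t)) = c * norm (T (circle_point ((F ^^ n) t)))"
    by (simp add: c_def)
  with eq show ?case by simp
qed simp

lemma norm_T_funpow_add:
  "norm ((T ^^ (m + n)) (circle_point t)) =
    norm ((T ^^ n) (circle_point t)) * norm ((T ^^ m) (circle_point ((F ^^ n) t)))"
proof -
  have "(T ^^ (m + n)) (circle_point t) = (T ^^ m) ((T ^^ n) (circle_point t))"
    by (simp add: funpow_add)
  also have "\<dots> = norm ((T ^^ n) (circle_point t)) *\<^sub>R (T ^^ m) (circle_point ((F ^^ n) t))"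
    by (subst T_funpow_circle_point) (simp only: T_map_funpow_scaleR norm_ge_zero)
  finally show ?thesis by simp
qed

text \<open>By \<open>stretch_add\<close> a multiplicative cocycle over \<open>F\<close>; it links
  the growth of vectors to the derivative of \<open>F ^^ n\<close>.\<close>

definition stretch :: "nat \<Rightarrow> real \<Rightarrow> real" where
  "stretch n t = norm ((T ^^ n) (circle_point t))"

lemma stretch_pos: "stretch n t > 0"
  by (simp add: stretch_def)

lemma stretch_add: "stretch (m + n) t = stretch n t * stretch m ((F ^^ n) t)"
  unfolding stretch_def by (rule norm_T_funpow_add)

lemma stretch_0 [simp]: "stretch 0 t = 1"
  by (simp add: stretch_def)

lemma stretch_diff_int: "stretch n (t - of_int m) = stretch n t"
proof -
  have "circle_point (t - of_int m) = circle_point t" by (simp add: circle_point_eq_iff)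
  then show ?thesis by (simp add: stretch_def)
qed

lemma continuous_stretch: "continuous_on S (stretch n)"
  unfolding stretch_def
  by (intro continuous_intros continuous_on_T_map_funpow)

lemma derivative_funpow: "((F ^^ n) has_real_derivative 1 / (stretch n t)\<^sup>2) (at t)"
proof (induction n)
  case (Suc n)
  have "(F has_real_derivative 1 / (stretch 1 ((F ^^ n) t))\<^sup>2) (at ((F ^^ n) t))"
    using angular_derivative[OF cont lift] by (simp add: stretch_def)
  from DERIV_chain[OF this Suc] show ?case
    using stretch_add[of 1 n t] by (simp add: o_def power_mult_distrib mult.commute)
qed (simp add: id_def)

text \<open>At \<open>t\<close> itself the derivative of the iterate is at most
  \<open>1 / (A * \<rho> ^ n)\<^sup>2\<close>. At nearby points each step may lose a factor
  \<open>\<rho>\<close>, which still leaves exponential contraction, and \<open>\<delta>\<close> is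
  the same for all \<open>t\<close>.\<close>

lemma contraction:
  assumes "A > 0" "\<rho> > 1"
  obtains \<delta> where "\<delta> > 0" "\<And>t s n. (\<And>n. stretch n t \<ge> A * \<rho> ^ n) \<Longrightarrow> \<bar>s - t\<bar> \<le> \<delta> \<Longrightarrow>
    \<bar>(F ^^ n) s - (F ^^ n) t\<bar> \<le> \<bar>s - t\<bar> / (A\<^sup>2 * \<rho> ^ n)"
proof -
  define h where "h t = 1 / (stretch 1 t)\<^sup>2" for t
  have h_pos: "h t > 0" for t using stretch_pos[of 1 t] by (simp add: h_def)
  \<comment> \<open>\<open>h\<close> has period 1, so \<open>t\<close> can be moved into the unit
    interval; the margin of 1 on either side leaves room for \<open>s\<close>.\<close>
  have "uniformly_continuous_on {-1..2} (\<lambda>t. ln (h t))"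
    unfolding h_def using stretch_pos[of 1]
    by (intro compact_uniformly_continuous continuous_intros continuous_stretch)
      (auto simp: less_le)
  then obtain \<delta>0 where \<delta>0: "\<delta>0 > 0" "\<And>s t. s \<in> {-1..2} \<Longrightarrow> t \<in> {-1..2} \<Longrightarrow> dist s t < \<delta>0 \<Longrightarrow>
      dist (ln (h s)) (ln (h t)) < ln \<rho>"
    unfolding uniformly_continuous_on_def using assms(2) by (metis ln_gt_zero)
  define \<delta>1 where "\<delta>1 = min (\<delta>0 / 2) 1"
  have \<delta>1: "\<delta>1 > 0" using \<delta>0(1) by (simp add: \<delta>1_def)
  have h_le: "h s \<le> \<rho> * h t" if "\<bar>s - t\<bar> \<le> \<delta>1" for s t
  proof -
    define m where "m = \<lfloor>t\<rfloor>"
    have m: "0 \<le> t - m" "t - m \<le> 1" unfolding m_def by linarith+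
    moreover have "\<bar>s - t\<bar> \<le> 1" "\<bar>s - t\<bar> < \<delta>0" using that \<delta>0(1) unfolding \<delta>1_def by linarith+
    ultimately have "dist (ln (h (s - m))) (ln (h (t - m))) < ln \<rho>"
      by (intro \<delta>0(2)) (auto simp: dist_real_def)
    then have "ln (h s) < ln \<rho> + ln (h t)"
      unfolding h_def stretch_diff_int by (simp add: dist_real_def)
    also have "\<dots> = ln (\<rho> * h t)" using assms(2) h_pos[of t] by (simp add: ln_mult_pos)
    finally show ?thesis using assms(2) h_pos by (simp add: less_imp_le)
  qed
  have F_lip: "\<bar>F x - F y\<bar> \<le> \<rho> * h y * \<bar>x - y\<bar>" if "\<bar>x - y\<bar> \<le> \<delta>1" for x y
  proof -
    have "norm (F x - F y) \<le> \<rho> * h y * norm (x - y)"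
    proof (rule field_differentiable_bound[of "cball y \<delta>1"])
      fix z assume z: "z \<in> cball y \<delta>1"
      show "(F has_real_derivative h z) (at z within cball y \<delta>1)"
        using derivative_funpow[of 1 z] unfolding h_def by (simp add: has_field_derivative_at_within)
      show "norm (h z) \<le> \<rho> * h y"
        using h_le[of z y] h_pos[of z] z by (simp add: dist_real_def abs_minus_commute)
    qed (use that \<delta>1 in \<open>auto simp: dist_real_def abs_minus_commute\<close>)
    then show ?thesis by simp
  qed
  \<comment> \<open>The factor \<open>A\<^sup>2\<close> keeps the two orbits within
    \<open>\<delta>1\<close> at every time, so that \<open>F_lip\<close> applies at each step of the
    induction.\<close>
  define \<delta> where "\<delta> = \<delta>1 * A\<^sup>2"
  have "\<bar>(F ^^ n) s - (F ^^ n) t\<bar> \<le> \<bar>s - t\<bar> / (A\<^sup>2 * \<rho> ^ n)"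
    if grow: "\<And>n. stretch n t \<ge> A * \<rho> ^ n" and close: "\<bar>s - t\<bar> \<le> \<delta>" for s t n
  proof -
    have bound: "\<rho> ^ n / (stretch n t)\<^sup>2 * \<bar>s - t\<bar> \<le> \<bar>s - t\<bar> / (A\<^sup>2 * \<rho> ^ n)" for n
    proof -
      have "(A * \<rho> ^ n)\<^sup>2 \<le> (stretch n t)\<^sup>2"
        using grow[of n] assms by (intro power_mono) auto
      then have "\<rho> ^ n / (stretch n t)\<^sup>2 \<le> \<rho> ^ n / (A * \<rho> ^ n)\<^sup>2"
        using assms stretch_pos[of n t] by (intro divide_left_mono) auto
      also have "\<dots> = 1 / (A\<^sup>2 * \<rho> ^ n)"
        using assms by (simp add: power_mult_distrib power2_eq_square)
      finally show ?thesis using mult_right_mono[of _ _ "\<bar>s - t\<bar>"] by fastforce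
    qed
    have small: "\<bar>s - t\<bar> / (A\<^sup>2 * \<rho> ^ n) \<le> \<delta>1" for n
    proof -
      have "1 \<le> \<rho> ^ n" using assms by simp
      then have "\<delta>1 * A\<^sup>2 * 1 \<le> \<delta>1 * A\<^sup>2 * \<rho> ^ n"
        using \<delta>1 by (intro mult_left_mono) auto
      then have "\<bar>s - t\<bar> \<le> \<delta>1 * (A\<^sup>2 * \<rho> ^ n)" using close by (simp add: \<delta>_def mult.assoc)
      then show ?thesis using assms by (simp add: pos_divide_le_eq)
    qed
    have "\<bar>(F ^^ n) s - (F ^^ n) t\<bar> \<le> \<rho> ^ n / (stretch n t)\<^sup>2 * \<bar>s - t\<bar>"
    proof (induction n)
      case (Suc n)
      have "\<bar>(F ^^ n) s - (F ^^ n) t\<bar> \<le> \<delta>1"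
        using Suc bound[of n] small[of n] by linarith
      then have "\<bar>F ((F ^^ n) s) - F ((F ^^ n) t)\<bar> \<le> \<rho> * h ((F ^^ n) t) * \<bar>(F ^^ n) s - (F ^^ n) t\<bar>"
        by (rule F_lip)
      also have "\<dots> \<le> \<rho> * h ((F ^^ n) t) * (\<rho> ^ n / (stretch n t)\<^sup>2 * \<bar>s - t\<bar>)"
        using Suc assms h_pos[of "(F ^^ n) t"] by (intro mult_left_mono) auto
      also have "\<dots> = \<rho> ^ Suc n / (stretch (Suc n) t)\<^sup>2 * \<bar>s - t\<bar>"
        using stretch_add[of 1 n t] by (simp add: h_def power_mult_distrib mult.commute)
      finally show ?case by simp
    qed simp
    with bound[of n] show ?thesis by linarith
  qed
  moreover have "\<delta> > 0" using \<delta>1 assms by (simp add: \<delta>_def)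
  ultimately show ?thesis using that by blast
qed

text \<open>For large \<open>n\<close> the iterate halves distances to the image of \<open>t\<close>
  on a \<open>\<delta>\<close>-interval around \<open>t\<close>, and returns \<open>t\<close> to
  within \<open>\<delta> / 2\<close> modulo an integer. So the shifted iterate maps the interval
  into itself and has a fixed point there.\<close>

lemma periodic_point_of_close_return:
  assumes "A > 0" "\<rho> > 1"
    and return: "\<And>N \<epsilon>. \<epsilon> > 0 \<Longrightarrow> \<exists>t n. \<exists>k::int. n \<ge> N \<and> (\<forall>n. stretch n t \<ge> A * \<rho> ^ n) \<and>
      \<bar>(F ^^ n) t - t - k\<bar> < \<epsilon>"
  shows "\<exists>q\<ge>1. \<exists>s. \<exists>p::int. (F ^^ q) s = s + p"
proof -
  obtain \<delta> where \<delta>: "\<delta> > 0" "\<And>t s n. (\<And>n. stretch n t \<ge> A * \<rho> ^ n) \<Longrightarrow> \<bar>s - t\<bar> \<le> \<delta> \<Longrightarrow>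
    \<bar>(F ^^ n) s - (F ^^ n) t\<bar> \<le> \<bar>s - t\<bar> / (A\<^sup>2 * \<rho> ^ n)"
    using contraction[OF assms(1,2)] by blast
  obtain N where N: "2 / A\<^sup>2 < \<rho> ^ N"
    using real_arch_pow[OF assms(2)] by blast
  \<comment> \<open>\<open>Suc N\<close> in place of \<open>N\<close> also ensures that the period
    \<open>n\<close> is at least 1.\<close>
  obtain t n k where n: "n \<ge> Suc N" and grow: "\<And>n. stretch n t \<ge> A * \<rho> ^ n"
    and k: "\<bar>(F ^^ n) t - t - of_int k\<bar> < \<delta> / 2"
    using return[of "\<delta> / 2" "Suc N"] \<delta>(1) by auto
  have "\<rho> ^ N \<le> \<rho> ^ n" using n assms(2) by (intro power_increasing) auto
  with N have "2 / A\<^sup>2 < \<rho> ^ n" by linarith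
  then have two: "A\<^sup>2 * \<rho> ^ n \<ge> 2" using assms(1) by (simp add: field_simps)
  have inside: "\<bar>(F ^^ n) s - of_int k - t\<bar> \<le> \<delta>" if "\<bar>s - t\<bar> \<le> \<delta>" for s
  proof -
    have "\<bar>(F ^^ n) s - (F ^^ n) t\<bar> \<le> \<bar>s - t\<bar> / (A\<^sup>2 * \<rho> ^ n)"
      using \<delta>(2)[OF grow that] .
    also have "\<dots> \<le> \<delta> / 2" using that two \<delta>(1) by (intro frac_le) auto
    finally show ?thesis using k by linarith
  qed
  interpret G: degree_one_lift "F ^^ n" by (rule degree_one_lift_funpow)
  have "\<exists>s. t - \<delta> \<le> s \<and> s \<le> t + \<delta> \<and> s - (F ^^ n) s = - of_int k"
    using inside[of "t - \<delta>"] inside[of "t + \<delta>"] \<delta>(1)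
    by (intro IVT') (auto intro!: continuous_intros continuous_on_subset[OF G.cont])
  then have "\<exists>s. (F ^^ n) s = s + of_int k" by (metis add.commute add_diff_cancel_left' diff_eq_eq diff_minus_eq_add)
  then show ?thesis using n by (intro exI[of _ n]) auto
qed

end

section \<open>Close returns and periodic orbits\<close>


text \<open>Along the increasing enumeration of \<open>I\<close> some subsequence converges, hence
  is Cauchy; places \<open>M\<close> and \<open>M + N\<close> of it have indices at least
  \<open>N\<close> apart.\<close>

lemma frequent_close_pair:
  fixes x :: "nat \<Rightarrow> real"
  assumes "bounded (range x)" "infinite I" "\<epsilon> > 0"
  obtains i j where "i \<in> I" "j \<in> I" "j \<ge> i + N" "\<bar>x i - x j\<bar> < \<epsilon>"
proof -
  define y where "y = x \<circ> enumerate I"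
  have "bounded (range y)"
    using assms(1) by (rule bounded_subset) (auto simp: y_def)
  then obtain l r where r: "strict_mono r" "(y \<circ> r) \<longlonglongrightarrow> l"
    using bounded_imp_convergent_subsequence by blast
  then have "Cauchy (y \<circ> r)" using LIMSEQ_imp_Cauchy by blast
  then obtain M where "\<And>m n. m \<ge> M \<Longrightarrow> n \<ge> M \<Longrightarrow> dist ((y \<circ> r) m) ((y \<circ> r) n) < \<epsilon>"
    using assms(3) unfolding Cauchy_def by blast
  then have close: "dist ((y \<circ> r) M) ((y \<circ> r) (M + N)) < \<epsilon>" by simp
  have mono: "strict_mono (enumerate I \<circ> r)"
    using strict_mono_o[OF strict_mono_enumerate[OF assms(2)] r(1)] .
  have "(enumerate I \<circ> r) (M + n) \<ge> (enumerate I \<circ> r) M + n" for n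
  proof (induction n)
    case (Suc n)
    then show ?case using strict_monoD[OF mono, of "M + n" "M + Suc n"] by linarith
  qed simp
  from this[of N] close show ?thesis
    using that[of "enumerate I (r M)" "enumerate I (r (M + N))"] enumerate_in_set[OF assms(2)]
    by (simp add: y_def dist_real_def)
qed

context T_map_lift
begin

text \<open>Circle form of time reversal: the swap becomes the reflection \<open>1 / 4 - t\<close>,
  which conjugates the circle map with its inverse. For the lift this holds modulo integers.\<close>

lemma reversal: "circle_point (F (1 / 4 - F t)) = circle_point (1 / 4 - t)"
proof -
  define c where "c = stretch 1 t"
  have c: "c > 0" by (simp add: c_def stretch_pos)
  have "T (circle_point t) = c *\<^sub>R circle_point (F t)"
    using T_circle_point[of t] by (simp add: c_def stretch_def)
  then have "prod.swap (T (circle_point t)) = c *\<^sub>R circle_point (1 / 4 - F t)"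
    by (simp add: scaleR_swap swap_circle_point)
  then have "T (c *\<^sub>R circle_point (1 / 4 - F t)) = circle_point (1 / 4 - t)"
    by (metis T_map_swap_T_map swap_circle_point)
  then have eq: "c *\<^sub>R T (circle_point (1 / 4 - F t)) = circle_point (1 / 4 - t)"
    using c by (simp add: T_map_scaleR)
  from arg_cong[OF this, of norm] have "norm (T (circle_point (1 / 4 - F t))) = inverse c"
    using c by (simp add: field_simps)
  with eq show ?thesis using c by (simp add: lift S_map_def)
qed

lemma reversal_funpow: "(F ^^ n) (1 / 4 - (F ^^ n) t) - (1 / 4 - t) \<in> \<int>"
proof (induction n arbitrary: t)
  case (Suc n)
  obtain m :: int where m: "(F ^^ n) (1 / 4 - (F ^^ n) (F t)) - (1 / 4 - F t) = m"
    using Suc Ints_cases by metis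
  have "F (1 / 4 - F t) - (1 / 4 - t) \<in> \<int>"
    using reversal circle_point_eq_iff by blast
  then obtain k :: int where k: "F (1 / 4 - F t) - (1 / 4 - t) = k"
    using Ints_cases by metis
  have "(F ^^ Suc n) (1 / 4 - (F ^^ Suc n) t) = F ((F ^^ n) (1 / 4 - (F ^^ n) (F t)))"
    by (simp add: funpow_swap1)
  also have "(F ^^ n) (1 / 4 - (F ^^ n) (F t)) = (1 / 4 - F t) + of_int m"
    using m by simp
  also have "F \<dots> = F (1 / 4 - F t) + of_int m" by (rule add_int)
  finally have "(F ^^ Suc n) (1 / 4 - (F ^^ Suc n) t) - (1 / 4 - t) = of_int (k + m)"
    using k by simp
  then show ?case by (simp only: Ints_of_int)
qed simp

text \<open>Each point of one orbit of \<open>F\<close>, or its reflection, is a direction of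
  forward growth. One alternative occurs infinitely often, and two such points close modulo 1 give
  the close return.\<close>

lemma periodic_point_if_unbounded:
  assumes "\<And>u. norm u = 1 \<Longrightarrow> \<exists>n. norm (int_iterate T n u) > 2"
  shows "\<exists>q\<ge>1. \<exists>s. \<exists>p::int. (F ^^ q) s = s + p"
proof -
  obtain A \<rho> where A: "A > 0" "\<rho> > 1" and grow: "\<And>v. norm v = 1 \<Longrightarrow>
    (\<forall>n. norm ((T ^^ n) v) \<ge> A * \<rho> ^ n) \<or> (\<forall>n. norm ((T ^^ n) (prod.swap v)) \<ge> A * \<rho> ^ n)"
    using exponential_growth[of a b] assms by blast
  define \<theta> where "\<theta> i = (F ^^ i) 0" for i
  define x where "x i = frac (\<theta> i)" for i
  have bdd: "bounded (range x)"
    unfolding bounded_iff x_def by (intro exI[of _ 1]) (auto simp: frac_lt_1 less_imp_le)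
  define G where "G t \<longleftrightarrow> (\<forall>n. stretch n t \<ge> A * \<rho> ^ n)" for t
  have "G t \<or> G (1 / 4 - t)" for t
    using grow[of "circle_point t"] by (simp add: G_def stretch_def swap_circle_point)
  then have "UNIV = {i. G (\<theta> i)} \<union> {i. G (1 / 4 - \<theta> i)}" by blast
  then have inf: "infinite {i. G (\<theta> i)} \<or> infinite {i. G (1 / 4 - \<theta> i)}"
    by (metis finite_Un infinite_UNIV_nat)
  have \<theta>_add: "(F ^^ n) (\<theta> i) = \<theta> (n + i)" for n i
    by (simp add: \<theta>_def funpow_add)
  show ?thesis
  proof (rule periodic_point_of_close_return[OF A])
    fix N and \<epsilon> :: real assume "\<epsilon> > 0"
    show "\<exists>t n. \<exists>k::int. n \<ge> N \<and> (\<forall>n. stretch n t \<ge> A * \<rho> ^ n) \<and> \<bar>(F ^^ n) t - t - k\<bar> < \<epsilon>"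
      using inf
    proof
      assume "infinite {i. G (\<theta> i)}"
      then obtain i j where ij: "G (\<theta> i)" "j \<ge> i + N" "\<bar>x i - x j\<bar> < \<epsilon>"
        using frequent_close_pair[OF bdd _ \<open>\<epsilon> > 0\<close>, of "{i. G (\<theta> i)}" N] by blast
      have "(F ^^ (j - i)) (\<theta> i) - \<theta> i - of_int (\<lfloor>\<theta> j\<rfloor> - \<lfloor>\<theta> i\<rfloor>) = x j - x i"
        using ij(2) by (simp add: \<theta>_add x_def frac_def)
      with ij show ?thesis unfolding G_def
        by (intro exI[of _ "\<theta> i"] exI[of _ "j - i"] exI[of _ "\<lfloor>\<theta> j\<rfloor> - \<lfloor>\<theta> i\<rfloor>"])
          (simp add: abs_minus_commute)
    next
      assume "infinite {i. G (1 / 4 - \<theta> i)}"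
      \<comment> \<open>Reflection reverses time, so the return starts at the reflection of the
        later point \<open>\<theta> j\<close> and ends near that of \<open>\<theta> i\<close>; hence
        growth is demanded at \<open>j\<close>.\<close>
      then obtain i j where ij: "G (1 / 4 - \<theta> j)" "j \<ge> i + N" "\<bar>x i - x j\<bar> < \<epsilon>"
        using frequent_close_pair[OF bdd _ \<open>\<epsilon> > 0\<close>, of "{i. G (1 / 4 - \<theta> i)}" N] by blast
      obtain m :: int where "(F ^^ (j - i)) (1 / 4 - (F ^^ (j - i)) (\<theta> i)) - (1 / 4 - \<theta> i) = m"
        using reversal_funpow Ints_cases by metis
      then have "(F ^^ (j - i)) (1 / 4 - \<theta> j) - (1 / 4 - \<theta> j) - of_int (m + \<lfloor>\<theta> j\<rfloor> - \<lfloor>\<theta> i\<rfloor>) = x j - x i"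
        using ij(2) by (simp add: \<theta>_add x_def frac_def)
      with ij show ?thesis unfolding G_def
        by (intro exI[of _ "1 / 4 - \<theta> j"] exI[of _ "j - i"] exI[of _ "m + \<lfloor>\<theta> j\<rfloor> - \<lfloor>\<theta> i\<rfloor>"])
          (simp add: abs_minus_commute)
    qed
  qed
qed

text \<open>The direction of \<open>v\<close> converges to a fixed direction \<open>y\<close> of the
  shifted iterate. There \<open>T ^^ q\<close> acts as multiplication by \<open>\<eta>\<close>, and
  boundedness leaves only \<open>\<eta> = 1\<close>.\<close>

lemma periodic_vector_if_bounded:
  assumes q: "q \<ge> 1" and per: "(F ^^ q) s = s + of_int p"
    and v: "v \<noteq> 0" and bdd: "\<And>n. norm (int_iterate T n v) \<le> M"
  shows "\<exists>u. u \<noteq> 0 \<and> (T ^^ q) u = u"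
proof -
  interpret Fq: degree_one_lift "F ^^ q" by (rule degree_one_lift_funpow)
  \<comment> \<open>All integer translates of \<open>s\<close> are fixed by \<open>G\<close>. Two
    neighbouring ones enclose the orbit of \<open>t\<close>, which is monotone and therefore
    converges.\<close>
  define G where "G t = (F ^^ q) t - of_int p" for t
  have G_mono: "G x \<le> G y \<longleftrightarrow> x \<le> y" for x y
    using Fq.smono by (simp add: G_def strict_mono_less_eq)
  have G_cont: "isCont G x" for x
    unfolding G_def using Fq.cont by (intro continuous_intros) (simp add: continuous_on_eq_continuous_at)
  have Gs: "G (s + of_int k) = s + of_int k" for k
    using per by (simp add: G_def Fq.add_int)
  obtain t where t: "v = norm v *\<^sub>R circle_point t" using polar_form .
  define x where "x n = (G ^^ n) t" for n
  have x_Suc: "x (Suc n) = G (x n)" for n by (simp add: x_def)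
  have x_0: "x 0 = t" by (simp add: x_def)
  define m where "m = \<lfloor>t - s\<rfloor>"
  have x_bd: "s + of_int m \<le> x n \<and> x n \<le> s + of_int (m + 1)" for n
  proof (induction n)
    case 0
    show ?case unfolding x_0 m_def by linarith
  next
    case (Suc n)
    then show ?case using G_mono[of _ "x n"] G_mono[of "x n"] Gs[of m] Gs[of "m + 1"]
      unfolding x_Suc by metis
  qed
  have "monoseq x"
  proof (cases "t \<le> G t")
    case True
    have "x n \<le> x (Suc n)" for n
      by (induction n) (use True G_mono in \<open>simp_all add: x_0 x_Suc\<close>)
    then show ?thesis by (simp add: monoseq_Suc)
  next
    case False
    have "x (Suc n) \<le> x n" for n
      by (induction n) (use False G_mono in \<open>simp_all add: x_0 x_Suc\<close>)
    then show ?thesis by (simp add: monoseq_Suc)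
  qed
  moreover have "Bseq x"
  proof (rule BseqI')
    show "norm (x n) \<le> \<bar>s + of_int m\<bar> + \<bar>s + of_int (m + 1)\<bar>" for n
      using x_bd[of n] unfolding real_norm_def by linarith
  qed
  ultimately obtain y where y: "x \<longlonglongrightarrow> y"
    using Bseq_monoseq_convergent convergentD by blast
  have "(\<lambda>n. G (x n)) \<longlonglongrightarrow> G y" using G_cont y by (rule isCont_tendsto_compose)
  moreover have "(\<lambda>n. G (x n)) \<longlonglongrightarrow> y" using LIMSEQ_Suc[OF y] by (simp add: x_Suc)
  ultimately have Gy: "G y = y" by (rule LIMSEQ_unique)
  have stretch_x: "stretch (q * n) t = (\<Prod>i<n. stretch q (x i))" for n
  proof (induction n)
    case (Suc n)
    \<comment> \<open>The orbits under \<open>G\<close> and \<open>F ^^ q\<close> differ by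
      integers, to which \<open>stretch\<close> is blind.\<close>
    have "x n = (F ^^ (q * n)) t - of_int (int n * p)" for n
    proof (induction n)
      case (Suc n)
      have "x (Suc n) = (F ^^ q) ((F ^^ (q * n)) t - of_int (int n * p)) - of_int p"
        using Suc by (simp only: x_Suc G_def)
      also have "(F ^^ q) ((F ^^ (q * n)) t - of_int (int n * p)) = (F ^^ (q * Suc n)) t - of_int (int n * p)"
        by (simp only: funpow_diff_int funpow_add mult_Suc_right o_apply)
      finally show ?case by (simp add: algebra_simps)
    qed (simp add: x_0)
    then have "stretch q ((F ^^ (q * n)) t) = stretch q (x n)"
      by (simp only: stretch_diff_int)
    then show ?case using Suc stretch_add[of q "q * n" t] by simp
  qed simp
  have orbit: "norm v * (\<Prod>i<n. stretch q (x i)) \<le> M" for n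
  proof -
    have "norm (int_iterate T (int (q * n)) v) = norm v * stretch (q * n) t"
      unfolding int_iterate_nat stretch_def
      by (subst t) (simp add: T_map_funpow_scaleR)
    then show ?thesis using bdd stretch_x by metis
  qed
  define \<eta> where "\<eta> = stretch q y"
  have "\<eta> > 0" by (simp add: \<eta>_def stretch_pos)
  have "(F ^^ q) y = y + of_int p" using Gy by (simp add: G_def)
  then have "circle_point ((F ^^ q) y) = circle_point y" by (simp add: circle_point_eq_iff)
  then have eigen: "(T ^^ q) (circle_point y) = \<eta> *\<^sub>R circle_point y"
    using T_funpow_circle_point[of q y] by (simp add: \<eta>_def stretch_def)
  have "\<not> \<eta> > 1"
  proof
    assume "\<eta> > 1"
    define \<kappa> where "\<kappa> = (1 + \<eta>) / 2"
    have \<kappa>: "1 < \<kappa>" "\<kappa> < \<eta>" using \<open>\<eta> > 1\<close> by (simp_all add: \<kappa>_def)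
    have "(\<lambda>n. stretch q (x n)) \<longlonglongrightarrow> \<eta>"
      unfolding \<eta>_def using continuous_stretch[of UNIV q] y
      by (auto simp: continuous_on_eq_continuous_at intro: isCont_tendsto_compose)
    then have "\<forall>\<^sub>F n in sequentially. stretch q (x n) > \<kappa>"
      using \<kappa>(2) by (rule order_tendstoD)
    then obtain N where N: "\<And>n. n \<ge> N \<Longrightarrow> stretch q (x n) > \<kappa>"
      by (auto simp: eventually_sequentially)
    define c where "c = norm v * (\<Prod>i<N. stretch q (x i))"
    have c: "c > 0" using v stretch_pos by (simp add: c_def prod_pos)
    have grow: "norm v * (\<Prod>i<N + k. stretch q (x i)) \<ge> c * \<kappa> ^ k" for k
    proof (induction k)
      case (Suc k)
      have "0 \<le> c * \<kappa> ^ k" using c \<kappa> by simp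
      then have "c * \<kappa> ^ k * \<kappa> \<le> norm v * (\<Prod>i<N + k. stretch q (x i)) * stretch q (x (N + k))"
        using Suc N[of "N + k"] \<kappa> by (intro mult_mono[OF Suc]) linarith+
      then show ?case by (simp add: ac_simps)
    qed (simp add: c_def)
    obtain k where "M / c < \<kappa> ^ k" using real_arch_pow[OF \<kappa>(1)] by blast
    then have "M < c * \<kappa> ^ k" using c by (simp add: field_simps)
    then show False using grow[of k] orbit[of "N + k"] by linarith
  qed
  \<comment> \<open>Now \<open>G\<close> has derivative above 1 at \<open>y\<close>, so an orbit
    converging to \<open>y\<close> has to hit it exactly.\<close>
  moreover have "\<not> \<eta> < 1"
  proof
    assume "\<eta> < 1"
    have "(G has_real_derivative 1 / \<eta>\<^sup>2) (at y)"
      unfolding G_def \<eta>_def using derivative_funpow[of q y] by (auto intro!: derivative_eq_intros)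
    then have "((\<lambda>z. (G z - y) / (z - y)) \<longlongrightarrow> 1 / \<eta>\<^sup>2) (at y)"
      using Gy by (simp add: has_field_derivative_iff)
    moreover have "1 < 1 / \<eta>\<^sup>2"
      using \<open>\<eta> > 0\<close> \<open>\<eta> < 1\<close> by (simp add: power_less_one_iff)
    ultimately have "\<forall>\<^sub>F z in at y. (G z - y) / (z - y) > 1"
      by (rule order_tendstoD)
    then obtain d where d: "d > 0" "\<And>z. z \<noteq> y \<Longrightarrow> dist z y < d \<Longrightarrow> (G z - y) / (z - y) > 1"
      by (auto simp: eventually_at)
    have repel: "\<bar>z - y\<bar> \<le> \<bar>G z - y\<bar>" if "dist z y < d" for z
    proof (cases "z = y")
      case False
      from d(2)[OF this that] have "\<bar>(G z - y) / (z - y)\<bar> > 1" by linarith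
      then have "\<bar>G z - y\<bar> / \<bar>z - y\<bar> > 1" by simp
      then show ?thesis using False by (simp add: field_simps)
    qed simp
    obtain N where N: "\<And>n. n \<ge> N \<Longrightarrow> dist (x n) y < d"
      using y d(1) unfolding lim_sequentially by blast
    have away: "\<bar>x N - y\<bar> \<le> \<bar>x (N + k) - y\<bar>" for k
    proof (induction k)
      case (Suc k)
      then show ?case using repel[OF N[of "N + k"]] by (simp add: x_Suc)
    qed simp
    have "(\<lambda>k. \<bar>x (N + k) - y\<bar>) \<longlonglongrightarrow> \<bar>y - y\<bar>"
      using LIMSEQ_ignore_initial_segment[OF y, of N] by (intro tendsto_intros) (simp add: add.commute)
    then have "\<bar>x N - y\<bar> \<le> \<bar>y - y\<bar>"
      by (rule tendsto_lowerbound) (use away in auto)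
    then have xN: "x N = y" by simp
    \<comment> \<open>Injectivity of \<open>G\<close> carries the hit back to time 0, so
      \<open>v\<close> itself points in the direction \<open>y\<close>.\<close>
    have "x n = y \<Longrightarrow> t = y" for n
    proof (induction n)
      case (Suc n)
      then have "G (x n) = G y" by (simp add: x_Suc Gy)
      then have "x n = y" using G_mono by (metis order_antisym order_refl)
      then show ?case using Suc.IH by simp
    qed (simp add: x_0)
    with xN have "t = y" by blast
    have "v = norm v *\<^sub>R circle_point y" using t \<open>t = y\<close> by simp
    then have Tv: "(T ^^ (q * k)) v = \<eta> ^ k *\<^sub>R v" for k
    proof (induction k)
      case (Suc k)
      have "(T ^^ (q * Suc k)) v = (T ^^ q) (\<eta> ^ k *\<^sub>R v)"
        using Suc by (simp add: funpow_add)
      also have "\<dots> = \<eta> ^ k *\<^sub>R (T ^^ q) v"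
        using \<open>\<eta> > 0\<close> by (simp add: T_map_funpow_scaleR)
      also have "(T ^^ q) v = (T ^^ q) (norm v *\<^sub>R circle_point y)"
        using Suc.prems by (rule arg_cong)
      also have "\<dots> = norm v *\<^sub>R \<eta> *\<^sub>R circle_point y"
        by (simp only: T_map_funpow_scaleR[OF norm_ge_zero] eigen)
      also have "\<dots> = \<eta> *\<^sub>R norm v *\<^sub>R circle_point y" by (rule scaleR_left_commute)
      also have "norm v *\<^sub>R circle_point y = v" by (rule Suc.prems[symmetric])
      finally show ?case by (simp add: mult.commute)
    qed simp
    \<comment> \<open>Forward shrinking means backward growth: \<open>v\<close> is
      \<open>\<eta> ^ k\<close> times a vector of its past orbit, whose norm is at most
      \<open>M\<close>.\<close>
    have "norm v \<le> \<eta> ^ k * M" for k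
    proof -
      have "v = int_iterate T (- int (q * k) + int (q * k)) v"
        using int_iterate_nat[of T 0] by simp
      also have "\<dots> = \<eta> ^ k *\<^sub>R int_iterate T (- int (q * k)) v"
        unfolding int_iterate_add[OF bij_T_map] int_iterate_nat Tv
        using \<open>\<eta> > 0\<close> by (simp add: int_iterate_T_map_scaleR)
      finally have "norm v = \<eta> ^ k * norm (int_iterate T (- int (q * k)) v)"
        using \<open>\<eta> > 0\<close> by (metis abs_of_pos norm_scaleR zero_less_power)
      then show ?thesis using bdd \<open>\<eta> > 0\<close> by simp
    qed
    moreover have "(\<lambda>k. \<eta> ^ k * M) \<longlonglongrightarrow> 0 * M"
      using \<open>\<eta> > 0\<close> \<open>\<eta> < 1\<close> by (intro tendsto_intros LIMSEQ_realpow_zero) auto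
    ultimately have "norm v \<le> 0 * M"
      by (intro tendsto_lowerbound[of _ "0 * M"]) auto
    then show False using v by simp
  qed
  ultimately have "\<eta> = 1" by simp
  then show ?thesis using eigen by (intro exI[of _ "circle_point y"]) simp
qed

end

text \<open>The whole orbit, including the past, is finite: iterates depend only on the time modulo
  the period.\<close>

lemma bounded_orbit_of_periodic_point:
  fixes f :: "'a :: metric_space \<Rightarrow> 'a"
  assumes "bij f" "periodic_point f v"
  shows "bounded (two_sided_orbit f v)"
proof -
  obtain k where k: "k \<ge> 1" "(f ^^ k) v = v"
    using assms(2) by (auto simp: periodic_point_def)
  have f0: "int_iterate f 0 x = x" for x using int_iterate_nat[of f 0] by simp
  have pos: "int_iterate f (int (k * n)) v = v" for n
  proof (induction n)
    case (Suc n)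
    then show ?case using k(2) unfolding int_iterate_nat by (simp add: funpow_add)
  qed (simp add: f0)
  have mult: "int_iterate f (int k * j) v = v" for j
  proof (cases j rule: int_cases2)
    case (nonneg n)
    then show ?thesis using pos[of n] by simp
  next
    case (nonpos n)
    have "int_iterate f (int k * j) v = int_iterate f (int k * j) (int_iterate f (int (k * n)) v)"
      by (simp only: pos)
    also have "\<dots> = v" unfolding int_iterate_add[OF assms(1), symmetric] nonpos by (simp add: f0)
    finally show ?thesis .
  qed
  have "int_iterate f n v \<in> (\<lambda>i. int_iterate f i v) ` {0..<int k}" for n
  proof
    have "n = n mod int k + int k * (n div int k)" by simp
    then show "int_iterate f n v = int_iterate f (n mod int k) v"
      using int_iterate_add[OF assms(1)] mult by metis
    show "n mod int k \<in> {0..<int k}" using k(1) by simp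
  qed
  then have "two_sided_orbit f v \<subseteq> (\<lambda>i. int_iterate f i v) ` {0..<int k}"
    by (auto simp: two_sided_orbit_def)
  then show ?thesis by (meson finite_atLeastLessThan_int finite_imageI finite_imp_bounded finite_subset)
qed

theorem theorem2p1:
  "closed Omega_SB \<and>
   (\<forall>\<mu> \<nu> a b :: real. a = \<nu> + \<mu> \<longrightarrow> b = \<nu> - \<mu> \<longrightarrow>
      ((\<mu>, \<nu>) \<in> Omega_SB \<longleftrightarrow>
         (rotation_number (S_map a b) \<in> \<rat> \<and>
            (\<exists>v. v \<noteq> (0, 0) \<and> periodic_point (T_map a b) v)) \<or>
         rotation_number (S_map a b) \<notin> \<rat>))"
proof (intro conjI allI impI)
  show "closed Omega_SB" by (rule closed_Omega_SB)
next
  fix \<mu> \<nu> a b :: real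
  assume ab: "a = \<nu> + \<mu>" "b = \<nu> - \<mu>"
  obtain F where F: "circle_lift (S_map a b) F" using ex_circle_lift by blast
  then interpret T_map_lift a b F by unfold_locales
  note rational = rotation_number_rational_iff[OF F]
  note Omega = Omega_SB_iff_small_orbit[of \<mu> \<nu>, folded ab]
  have periodic: "\<exists>v. v \<noteq> (0, 0) \<and> periodic_point (T_map a b) v"
    if rot: "rotation_number (S_map a b) \<in> \<rat>" and mem: "(\<mu>, \<nu>) \<in> Omega_SB"
  proof -
    obtain q s and p :: int where q: "q \<ge> 1" "(F ^^ q) s = s + of_int p"
      using rot unfolding rational by blast
    obtain u where u: "norm u = 1" "\<And>n. norm (int_iterate (T_map a b) n u) \<le> 2"
      using mem unfolding Omega by blast
    then have "u \<noteq> 0" by auto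
    then obtain w where "w \<noteq> 0" "(T_map a b ^^ q) w = w"
      using periodic_vector_if_bounded[OF q _ u(2)] by blast
    then show ?thesis
      using q(1) unfolding periodic_point_def zero_prod_def by blast
  qed
  have "(\<mu>, \<nu>) \<in> Omega_SB" if "v \<noteq> (0, 0)" "periodic_point (T_map a b) v" for v
    using that bounded_orbit_of_periodic_point[OF bij_T_map]
    unfolding Omega_SB_def case_prod_conv mem_Collect_eq ab by blast
  \<comment> \<open>Contrapositive of \<open>periodic_point_if_unbounded\<close>: if no iterate of
    the lift moves a point by an integer, some unit vector has an orbit of norm at most 2.\<close>
  moreover have "(\<mu>, \<nu>) \<in> Omega_SB" if "rotation_number (S_map a b) \<notin> \<rat>"
    using that periodic_point_if_unbounded unfolding rational Omega by (metis not_less)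
  ultimately show "(\<mu>, \<nu>) \<in> Omega_SB \<longleftrightarrow>
         (rotation_number (S_map a b) \<in> \<rat> \<and>
            (\<exists>v. v \<noteq> (0, 0) \<and> periodic_point (T_map a b) v)) \<or>
         rotation_number (S_map a b) \<notin> \<rat>"
    using periodic by blast
qed

end
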